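(* On $\mathbb{S}^3\subset\mathbb{R}^4$, let $$q_-(u)=u_1^3-\frac12u_1,\qquad q_+(u)=(u_1^2-u_2^2)u_3-2u_1u_2u_4.$$ Both are odd spherical harmonics of degree three, and $$-V(q_-,q_-,1,1)=\|q_-\|_{L^2(\mathbb{S}^3)}^2=\frac{\pi^2}{32},\qquad V(q_-,q_-,q_-,q_-)=-\frac{3\pi^2}{128},$$ $$-V(q_+,q_+,1,1)=\|q_+\|_{L^2(\mathbb{S}^3)}^2=\frac{\pi^2}{12},\qquad V(q_+,q_+,q_+,q_+)=\frac{\pi^2}{7}.$$ Consequently, for every $r>0$ and all sufficiently small nonzero $\varepsilon$, each function $h_{\varepsilon,\pm}=r+\varepsilon q_\pm$ is the support function of a $C^\infty$ convex body of class $C^2_+$ and constant width $2r$. Its quartic invariant $V(h_{\mathrm{odd}},h_{\mathrm{odd}},h_{\mathrm{odd}},h_{\mathrm{odd}})$, where $h_{\mathrm{odd}}$ is the odd part of $h_{\varepsilon,\pm}$, equals $\varepsilon^4V(q_\pm,q_\pm,q_\pm,q_\pm)$. Hence both signs of the quartic invariant occur among constant-width bodies arbitrarily close to $rB^4$.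
   Context: For $C^2$ functions $f_1,\ldots,f_4$ on $\mathbb{S}^3$, the mixed volume is $$V(f_1,f_2,f_3,f_4)=\frac14\int_{\mathbb{S}^3}f_1\,D_3(Q_{f_2},Q_{f_3},Q_{f_4})\,\mathrm{d}\sigma,\qquad Q_f=\nabla^2_{\mathbb{S}^3}f+f\,\mathrm{Id},$$ where $\sigma$ is the (unnormalized) surface measure, $\nabla^2_{\mathbb{S}^3}$ is the covariant Hessian and $D_3$ is the polarized determinant (symmetric trilinear form with $D_3(A,A,A)=\det A$) on symmetric endomorphisms of the three-dimensional tangent space. It is the multilinear extension of the usual mixed volume of convex bodies, identified with their support functions $h_K(u)=\max_{x\in K}\langle x,u\rangle$; the function $1$ is the support function of the unit ball $B^4$. A convex body is of class $C^2_+$ if its boundary is $C^2$ with positive Gauss curvature. $K$ has constant width $2r$ if $h_K(u)+h_K(-u)=2r$ for all $u$. The odd part of $h$ is $h_{\mathrm{odd}}(u)=\frac{h(u)-h(-u)}2$. Closeness of bodies is in the Hausdorff metric. *)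

theory Defs
  imports "HOL-Analysis.Analysis" "HOL-Library.Extended_Nat"
begin

section \<open>Spherical harmonics and the surface measure\<close>

definition laplacian :: "('a::euclidean_space \<Rightarrow> real) \<Rightarrow> 'a \<Rightarrow> real" where
  "laplacian p x =
     (\<Sum>b\<in>Basis. frechet_derivative (\<lambda>y. frechet_derivative p (at y) b) (at x) b)"

text \<open>
  Restrictions to the unit sphere of homogeneous harmonic polynomials. A function on the sphere is
  represented by any function on the ambient space; only its values on the sphere are used, here
  and in everything below.
\<close>

definition spherical_harmonic :: "nat \<Rightarrow> ('a::euclidean_space \<Rightarrow> real) \<Rightarrow> bool" where
  "spherical_harmonic k f \<longleftrightarrow>
     (\<exists>p. real_polynomial_function p \<and> (\<forall>t x. p (t *\<^sub>R x) = t ^ k * p x) \<and>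
          (\<forall>x. laplacian p x = 0) \<and> (\<forall>u\<in>sphere 0 1. f u = p u))"

definition odd_on_sphere :: "('a::euclidean_space \<Rightarrow> real) \<Rightarrow> bool" where
  "odd_on_sphere f \<longleftrightarrow> (\<forall>u\<in>sphere 0 1. f (- u) = - f u)"

text \<open>
  The unnormalized surface measure, as the cone measure: the measure of \<open>A\<close> is the dimension times
  the Lebesgue measure of \<open>{t *\<^sub>R u | t u. 0 < t \<and> t < 1 \<and> u \<in> A}\<close>. Note that \<open>sgn x = x /\<^sub>R norm x\<close>.
\<close>

definition sphere_measure :: "'a::euclidean_space measure" where
  "sphere_measure =
     scale_measure (of_nat DIM('a))
       (distr (restrict_space lborel (ball 0 1 - {0})) (restrict_space borel (sphere 0 1)) sgn)"

definition sphere_L2_norm :: "('a::euclidean_space \<Rightarrow> real) \<Rightarrow> real" where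
  "sphere_L2_norm f = sqrt (LINT u|sphere_measure. (f u)\<^sup>2)"


section \<open>Determinants on three-dimensional tangent spaces\<close>

text \<open>
  For \<open>u \<noteq> 0\<close>, endomorphisms of the three-dimensional space of vectors orthogonal to \<open>u\<close> are
  represented by functions on \<open>real^4\<close>, of which only the restriction to that space is used. Their
  determinant is that of the matrix in an orthonormal basis, so it does not depend on the choice of
  the basis.
\<close>

definition tangent_frame :: "real^4 \<Rightarrow> real^4^3" where
  "tangent_frame u =
     (SOME e. (\<forall>i. (e $ i) \<bullet> u = 0) \<and> (\<forall>i j. (e $ i) \<bullet> (e $ j) = (if i = j then 1 else 0)))"

definition tangent_det :: "real^4 \<Rightarrow> (real^4 \<Rightarrow> real^4) \<Rightarrow> real" where
  "tangent_det u A = det (\<chi> i j. (tangent_frame u $ i) \<bullet> A (tangent_frame u $ j))"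

text \<open>The polarized determinant, given by the polarization identity for cubic forms.\<close>

definition mixed_discriminant ::
  "real^4 \<Rightarrow> (real^4 \<Rightarrow> real^4) \<Rightarrow> (real^4 \<Rightarrow> real^4) \<Rightarrow> (real^4 \<Rightarrow> real^4) \<Rightarrow> real" where
  "mixed_discriminant u A B C =
     (tangent_det u (\<lambda>v. A v + B v + C v)
      - tangent_det u (\<lambda>v. A v + B v) - tangent_det u (\<lambda>v. A v + C v) - tangent_det u (\<lambda>v. B v + C v)
      + tangent_det u A + tangent_det u B + tangent_det u C) / 6"


section \<open>The covariant Hessian and the mixed volume\<close>

text \<open>
  A derivative at a point of a hypersurface \<open>within\<close> the hypersurface is determined on tangent
  vectors only, so it is evaluated at, or constrained on, tangent vectors only. The gradient is the
  tangent vector representing the differential, and the Levi-Civita connection of the sphere is the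
  tangential part of the derivative in the ambient space.
\<close>

definition tangent_proj :: "'a::euclidean_space \<Rightarrow> 'a \<Rightarrow> 'a" where
  "tangent_proj u x = x - (x \<bullet> u) *\<^sub>R u"

definition sphere_grad :: "('a::euclidean_space \<Rightarrow> real) \<Rightarrow> 'a \<Rightarrow> 'a" where
  "sphere_grad f u =
     (THE g. g \<bullet> u = 0 \<and> (f has_derivative (\<lambda>v. g \<bullet> v)) (at u within sphere 0 1))"

definition sphere_hessian :: "('a::euclidean_space \<Rightarrow> real) \<Rightarrow> 'a \<Rightarrow> 'a \<Rightarrow> 'a" where
  "sphere_hessian f u v =
     tangent_proj u (frechet_derivative (sphere_grad f) (at u within sphere 0 1) v)"

definition Q_op :: "('a::euclidean_space \<Rightarrow> real) \<Rightarrow> 'a \<Rightarrow> 'a \<Rightarrow> 'a" where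
  "Q_op f u v = sphere_hessian f u v + f u *\<^sub>R v"

definition mixed_volume ::
  "(real^4 \<Rightarrow> real) \<Rightarrow> (real^4 \<Rightarrow> real) \<Rightarrow> (real^4 \<Rightarrow> real) \<Rightarrow> (real^4 \<Rightarrow> real) \<Rightarrow> real" where
  "mixed_volume f1 f2 f3 f4 =
     (1/4) * (LINT u|sphere_measure. f1 u * mixed_discriminant u (Q_op f2 u) (Q_op f3 u) (Q_op f4 u))"

definition odd_part :: "('a::euclidean_space \<Rightarrow> real) \<Rightarrow> 'a \<Rightarrow> real" where
  "odd_part h u = (h u - h (- u)) / 2"

definition quartic_invariant :: "(real^4 \<Rightarrow> real) \<Rightarrow> real" where
  "quartic_invariant h = mixed_volume (odd_part h) (odd_part h) (odd_part h) (odd_part h)"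


section \<open>Convex bodies\<close>

definition convex_body :: "'a::euclidean_space set \<Rightarrow> bool" where
  "convex_body K \<longleftrightarrow> compact K \<and> convex K \<and> interior K \<noteq> {}"

definition support_fun :: "'a::euclidean_space set \<Rightarrow> 'a \<Rightarrow> real" where
  "support_fun K u = (SUP x\<in>K. x \<bullet> u)"

definition is_support_fun_of :: "('a::euclidean_space \<Rightarrow> real) \<Rightarrow> 'a set \<Rightarrow> bool" where
  "is_support_fun_of h K \<longleftrightarrow> (\<forall>u\<in>sphere 0 1. h u = support_fun K u)"

definition constant_width :: "'a::euclidean_space set \<Rightarrow> real \<Rightarrow> bool" where
  "constant_width K w \<longleftrightarrow> (\<forall>u\<in>sphere 0 1. support_fun K u + support_fun K (- u) = w)"

text \<open>Used for nonempty compact sets only.\<close>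

definition hausdorff_dist :: "'a::metric_space set \<Rightarrow> 'a set \<Rightarrow> real" where
  "hausdorff_dist A B = max (SUP a\<in>A. infdist a B) (SUP b\<in>B. infdist b A)"

primrec Cn_on :: "nat \<Rightarrow> ('a::euclidean_space \<Rightarrow> real) \<Rightarrow> 'a set \<Rightarrow> bool" where
  "Cn_on 0 f U \<longleftrightarrow> continuous_on U f"
| "Cn_on (Suc n) f U \<longleftrightarrow>
     (\<forall>x\<in>U. f differentiable (at x)) \<and> (\<forall>v. Cn_on n (\<lambda>x. frechet_derivative f (at x) v) U)"

text \<open>For \<open>k = \<infinity>\<close> this is smoothness; it is meant for open sets \<open>U\<close>.\<close>

definition Ck_on :: "enat \<Rightarrow> ('a::euclidean_space \<Rightarrow> real) \<Rightarrow> 'a set \<Rightarrow> bool" where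
  "Ck_on k f U \<longleftrightarrow> (\<forall>n. enat n \<le> k \<longrightarrow> Cn_on n f U)"

definition Ck_hypersurface :: "enat \<Rightarrow> 'a::euclidean_space set \<Rightarrow> bool" where
  "Ck_hypersurface k M \<longleftrightarrow>
     (\<forall>p\<in>M. \<exists>U F. open U \<and> p \<in> U \<and> Ck_on k F U \<and>
        (\<forall>x\<in>U. \<exists>v. frechet_derivative F (at x) v \<noteq> 0) \<and> M \<inter> U = {x \<in> U. F x = 0})"

definition outer_normal :: "'a::euclidean_space set \<Rightarrow> 'a \<Rightarrow> 'a" where
  "outer_normal K p = (THE n. norm n = 1 \<and> (\<forall>x\<in>K. (x - p) \<bullet> n \<le> 0))"

text \<open>
  The determinant of the Weingarten map, i.e. of the differential of the Gauss map on the tangent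
  space of the boundary; with the outer normal, balls have positive curvature.
\<close>

definition gauss_curvature :: "(real^4) set \<Rightarrow> real^4 \<Rightarrow> real" where
  "gauss_curvature K p =
     tangent_det (outer_normal K p) (frechet_derivative (outer_normal K) (at p within frontier K))"

definition smooth_body :: "'a::euclidean_space set \<Rightarrow> bool" where
  "smooth_body K \<longleftrightarrow> convex_body K \<and> Ck_hypersurface \<infinity> (frontier K)"

definition C2_plus_body :: "(real^4) set \<Rightarrow> bool" where
  "C2_plus_body K \<longleftrightarrow>
     convex_body K \<and> Ck_hypersurface 2 (frontier K) \<and> (\<forall>p\<in>frontier K. gauss_curvature K p > 0)"


section \<open>The two cubic harmonics\<close>

definition q_minus :: "real^4 \<Rightarrow> real" where
  "q_minus u = (u $ 1) ^ 3 - (1/2) * u $ 1"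

definition q_plus :: "real^4 \<Rightarrow> real" where
  "q_plus u = ((u $ 1)\<^sup>2 - (u $ 2)\<^sup>2) * u $ 3 - 2 * u $ 1 * u $ 2 * u $ 4"

end

theory Submission
  imports Defs "HOL-Probability.Distributions"
begin

text \<open>
  Write \<open>q\<close> as a cubic form \<open>p x = B x x \<bullet> x / 6\<close> on \<open>\<real>\<^sup>4\<close>, with \<open>B\<close> symmetric trilinear. On tangent vectors at \<open>u\<close>
  the operator \<open>Q\<close> is then the compression of \<open>B u\<close> minus \<open>2 * p u\<close>; in the orthonormal frame obtained by
  multiplying \<open>u\<close> by the quaternion units its entries are polynomials, and so are its trace and determinant.
  The integrals of these polynomials over the sphere follow from the Gaussian moments.

  The map \<open>\<Phi> x = x + \<epsilon> * \<nabla>(p x / |x|\<^sup>2)\<close> is a small perturbation of the identity away from the origin, and it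
  maps the sphere of radius \<open>r\<close> onto the boundary of the body with support function \<open>r + \<epsilon> * q\<close>. Hence
  \<open>|\<Phi>\<^sup>-\<^sup>1 z|\<^sup>2 - r\<^sup>2\<close> is a smooth defining function of the boundary, and the Gauss map is \<open>\<Phi>\<^sup>-\<^sup>1 / r\<close>, whose
  differential is positive definite because that of \<open>\<Phi>\<close> is close to the identity.
\<close>


section \<open>Sphere calculus and orthonormal frames\<close>

text \<open>Gradient, Hessian and Gauss map are differentiated only within a hypersurface, where a
  derivative is determined on tangent vectors alone, and determinants are taken in an arbitrarily
  chosen frame. Hence each such derivative is pinned down along curves in the hypersurface, and each
  determinant is moved to an explicit frame.

  Origin of \<open>\<Phi>\<close>: the support function extends to
  \<open>r * norm x + \<epsilon> * cubic x / (x \<bullet> x)\<close>, homogeneous of degree one,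
  whose gradient sends a unit normal to its boundary point. That gradient is constant on rays, hence
  not invertible; replacing its radial part \<open>r *\<^sub>R sgn x\<close> by \<open>x\<close>
  changes nothing on the sphere of radius \<open>r\<close> and makes the differential invertible.

  The body is an intersection of half-spaces, so convexity is free; what has to be proved is that
  every bounding hyperplane touches it. One estimate, \<open>cubic_minus_dual\<close>, of second
  order in the distance of two unit vectors, yields this, the uniqueness of touching points and of
  normals, and the injectivity of \<open>\<Phi>\<close>.\<close>

lemma has_derivative_unique_along_curve:
  fixes c :: "real \<Rightarrow> 'a::real_normed_vector" and f :: "'a \<Rightarrow> 'b::real_normed_vector"
  assumes "(f has_derivative A) (at (c 0) within S)" "(f has_derivative A') (at (c 0) within S)"
    and c: "(c has_vector_derivative v) (at 0)" "\<And>t. c t \<in> S"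
  shows "A v = A' v"
proof -
  \<comment> \<open>The chain rule sees \<open>S\<close> only along the range of \<open>c\<close>,
    so every derivative within \<open>S\<close> must send \<open>v\<close> to the velocity of
    \<open>f \<circ> c\<close>, which does not depend on \<open>D\<close>.\<close>
  have *: "D v = vector_derivative (f \<circ> c) (at 0)"
    if D: "(f has_derivative D) (at (c 0) within S)" for D
  proof -
    have "(f has_derivative D) (at (c 0) within range c)"
      by (rule has_derivative_subset[OF D]) (use c in auto)
    with c(1) have "((f \<circ> c) has_derivative D \<circ> (\<lambda>t. t *\<^sub>R v)) (at 0)"
      unfolding has_vector_derivative_def by (rule diff_chain_within)
    moreover have "D \<circ> (\<lambda>t. t *\<^sub>R v) = (\<lambda>t. t *\<^sub>R D v)"
      using has_derivative_bounded_linear[OF D] by (auto simp: o_def linear_scale bounded_linear.linear)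
    ultimately have "((f \<circ> c) has_vector_derivative D v) (at 0)"
      by (simp add: has_vector_derivative_def)
    then show ?thesis
      by (simp add: vector_derivative_at)
  qed
  show ?thesis
    using *[OF assms(1)] *[OF assms(2)] by simp
qed

lemma norm_great_circle:
  fixes u w :: "'a::real_inner"
  assumes "norm u = 1" "norm w = 1" "w \<bullet> u = 0"
  shows "norm (cos t *\<^sub>R u + sin t *\<^sub>R w) = 1"
proof -
  have "u \<bullet> u = 1" "w \<bullet> w = 1" "u \<bullet> w = 0"
    using assms by (simp_all add: norm_eq_1 inner_commute)
  then have "(cos t *\<^sub>R u + sin t *\<^sub>R w) \<bullet> (cos t *\<^sub>R u + sin t *\<^sub>R w) = (cos t)\<^sup>2 + (sin t)\<^sup>2"
    using assms(3) by (simp add: inner_simps power2_eq_square)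
  then show ?thesis
    by (simp add: norm_eq_1)
qed

lemma great_circle_has_vector_derivative:
  "((\<lambda>t. cos t *\<^sub>R u + sin t *\<^sub>R w) has_vector_derivative w) (at 0)"
  by (auto intro!: derivative_eq_intros)

text \<open>Great circles realize every unit tangent direction at \<open>u\<close>, and linearity
  rescales. Off the tangent space a derivative within the sphere is arbitrary.\<close>

lemma sphere_derivative_unique:
  fixes f :: "'a::euclidean_space \<Rightarrow> 'b::real_normed_vector"
  assumes A: "(f has_derivative A) (at u within sphere 0 1)"
      and A': "(f has_derivative A') (at u within sphere 0 1)"
      and u: "norm u = 1" and v: "v \<bullet> u = 0"
  shows "A v = A' v"
proof (cases "v = 0")
  case False
  define w where "w = sgn v"
  have w: "norm w = 1" "w \<bullet> u = 0"
    using False v by (auto simp: w_def norm_sgn sgn_div_norm)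
  have "A w = A' w"
    by (rule has_derivative_unique_along_curve[where c = "\<lambda>t. cos t *\<^sub>R u + sin t *\<^sub>R w" and S = "sphere 0 1" and f = f])
      (use A A' w u norm_great_circle[OF u w] in \<open>auto simp: great_circle_has_vector_derivative\<close>)
  moreover have "v = norm v *\<^sub>R w"
    using False by (simp add: w_def sgn_div_norm)
  ultimately show ?thesis
    using has_derivative_linear[OF A] has_derivative_linear[OF A']
    by (metis linear_scale)
next
  case True
  then show ?thesis
    using A A' by (simp add: has_derivative_linear linear_0)
qed

lemma sphere_grad_eqI:
  assumes u: "norm u = 1" and g: "g \<bullet> u = 0" "(f has_derivative (\<lambda>v. g \<bullet> v)) (at u within sphere 0 1)"
  shows "sphere_grad f u = g"
  unfolding sphere_grad_def
proof (rule the_equality)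
  fix g' assume g': "g' \<bullet> u = 0 \<and> (f has_derivative (\<lambda>v. g' \<bullet> v)) (at u within sphere 0 1)"
  \<comment> \<open>Both candidates are tangent, so their difference is an admissible test vector;
    its squared length comes out as zero.\<close>
  have "g' \<bullet> (g' - g) = g \<bullet> (g' - g)"
    by (rule sphere_derivative_unique[of f "\<lambda>v. g' \<bullet> v" u "\<lambda>v. g \<bullet> v"])
       (use g g' u in \<open>auto simp: inner_simps\<close>)
  then have "(g' - g) \<bullet> (g' - g) = 0"
    by (simp add: inner_simps)
  then show "g' = g"
    by simp
qed (use g in auto)

text \<open>Makes the Hessian accessible to ambient calculus: any differentiable field that extends
  the spherical gradient off the sphere may be differentiated in its place.\<close>

lemma sphere_hessian_eqI:
  assumes "norm u = 1" "v \<bullet> u = 0"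
    and grad: "\<And>y. norm y = 1 \<Longrightarrow> sphere_grad f y = G y" and G: "(G has_derivative G') (at u)"
  shows "sphere_hessian f u v = tangent_proj u (G' v)"
proof -
  have "(G has_derivative G') (at u within sphere 0 1)"
    using G has_derivative_at_withinI by blast
  then have *: "(sphere_grad f has_derivative G') (at u within sphere 0 1)"
    by (rule has_derivative_transform[rotated 2]) (use assms in auto)
  then have "(sphere_grad f has_derivative frechet_derivative (sphere_grad f) (at u within sphere 0 1))
      (at u within sphere 0 1)"
    by (metis differentiableI frechet_derivative_works)
  from sphere_derivative_unique[OF this * assms(1,2)] show ?thesis
    by (simp add: sphere_hessian_def)
qed

lemma Q_op_const:
  assumes "norm u = 1" "v \<bullet> u = 0"
  shows "Q_op (\<lambda>_. c) u v = c *\<^sub>R v"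
proof -
  have "sphere_grad (\<lambda>_. c) y = 0" if "norm y = 1" for y :: 'a
    by (rule sphere_grad_eqI) (use that in auto)
  then have "sphere_hessian (\<lambda>_. c) u v = tangent_proj u 0"
    by (intro sphere_hessian_eqI[where G = "\<lambda>_. 0" and G' = "\<lambda>_. 0"]) (use assms in auto)
  then show ?thesis
    by (simp add: Q_op_def tangent_proj_def)
qed

text \<open>A cubic form is stored through its second derivative: \<open>B x\<close> is the Hessian
  of \<open>cubic\<close> at \<open>x\<close>. Gradient, Laplacian and \<open>Q_op\<close> then
  become algebra in \<open>B\<close>, and one treatment serves both harmonics and their
  multiples.\<close>

locale symmetric_trilinear =
  fixes B :: "'a::euclidean_space \<Rightarrow> 'a \<Rightarrow> 'a"
  assumes bilinear: "bounded_bilinear B"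
    and commute: "B x y = B y x"
    and selfadjoint: "B x y \<bullet> z = y \<bullet> B x z"
begin

sublocale B: bounded_bilinear B
  by (rule bilinear)

definition cubic :: "'a \<Rightarrow> real" where "cubic x = (B x x \<bullet> x) / 6"

definition grad :: "'a \<Rightarrow> 'a" where "grad x = B x x /\<^sub>R 2"

text \<open>Euler's identity in degree three.\<close>

lemma inner_grad_self: "grad x \<bullet> x = 3 * cubic x"
  by (simp add: grad_def cubic_def)

lemma B_self: "B x x = 2 *\<^sub>R grad x"
  by (simp add: grad_def)

lemma cubic_has_derivative [derivative_intros]:
  "(cubic has_derivative (\<lambda>v. grad x \<bullet> v)) (at x within S)"
proof -
  have "(cubic has_derivative (\<lambda>v. (B x x \<bullet> v + (B x v + B v x) \<bullet> x) / 6)) (at x within S)"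
    unfolding cubic_def
    by (auto intro!: derivative_eq_intros B.FDERIV)
  moreover have "(B x x \<bullet> v + (B x v + B v x) \<bullet> x) / 6 = grad x \<bullet> v" for v
    using commute[of v x] selfadjoint[of x v x]
    by (simp add: grad_def inner_commute inner_add_right)
  ultimately show ?thesis
    by simp
qed

lemma grad_has_derivative [derivative_intros]:
  "(grad has_derivative B x) (at x within S)"
proof -
  have "(grad has_derivative (\<lambda>v. (B x v + B v x) /\<^sub>R 2)) (at x within S)"
    unfolding grad_def
    by (auto intro!: derivative_eq_intros B.FDERIV)
  moreover have "(B x v + B v x) /\<^sub>R 2 = B x v" for v
    using commute[of v x] by (simp flip: scaleR_2)
  ultimately show ?thesis
    by simp
qed

lemma cubic_scale: "cubic (t *\<^sub>R x) = t ^ 3 * cubic x"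
  by (simp add: cubic_def B.scaleR_left B.scaleR_right power3_eq_cube)

lemma cubic_minus: "cubic (- x) = - cubic x"
  by (simp add: cubic_def B.minus_left B.minus_right)

lemma laplacian_cubic: "laplacian cubic x = (\<Sum>b\<in>Basis. B x b \<bullet> b)"
proof -
  have 1: "frechet_derivative cubic (at y) = (\<lambda>v. grad y \<bullet> v)" for y
    using cubic_has_derivative frechet_derivative_at by metis
  have "((\<lambda>y. grad y \<bullet> b) has_derivative (\<lambda>v. B x v \<bullet> b)) (at x)" for b
    by (auto intro!: derivative_eq_intros)
  then have "frechet_derivative (\<lambda>y. grad y \<bullet> b) (at x) = (\<lambda>v. B x v \<bullet> b)" for b
    using frechet_derivative_at by metis
  with 1 show ?thesis
    by (simp add: laplacian_def)
qed

lemma sphere_grad_cubic: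
  assumes f: "\<And>y. norm y = 1 \<Longrightarrow> f y = cubic y" and u: "norm u = 1"
  shows "sphere_grad f u = grad u - (3 * cubic u) *\<^sub>R u"
proof (rule sphere_grad_eqI[OF u])
  have uu: "u \<bullet> u = 1"
    using u by (simp add: norm_eq_1)
  then show "(grad u - (3 * cubic u) *\<^sub>R u) \<bullet> u = 0"
    by (simp add: inner_simps inner_grad_self)
  \<comment> \<open>Subtracting a multiple of \<open>y \<bullet> y - 1\<close>, which vanishes on the sphere, makes the gradient tangent.\<close>
  have "((\<lambda>y. cubic y - 3 * cubic u * (y \<bullet> y - 1) / 2) has_derivative
      (\<lambda>v. (grad u - (3 * cubic u) *\<^sub>R u) \<bullet> v)) (at u within sphere 0 1)"
    by (auto intro!: derivative_eq_intros simp: inner_simps inner_commute)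
  then show "(f has_derivative (\<lambda>v. (grad u - (3 * cubic u) *\<^sub>R u) \<bullet> v)) (at u within sphere 0 1)"
    by (rule has_derivative_transform[rotated 2]) (use u f in \<open>auto simp: norm_eq_1\<close>)
qed

text \<open>Differentiating the radial correction of the gradient gives \<open>- 3 * cubic u\<close>
  times the identity plus a multiple of \<open>u\<close> that the projection kills; the zeroth-order
  term of \<open>Q_op\<close> adds \<open>cubic u\<close> back, which leaves the factor 2.\<close>

lemma Q_op_cubic:
  assumes f: "\<And>y. norm y = 1 \<Longrightarrow> f y = cubic y" and u: "norm u = 1" and v: "v \<bullet> u = 0"
  shows "Q_op f u v = tangent_proj u (B u v) - (2 * cubic u) *\<^sub>R v"
proof -
  have "((\<lambda>y. grad y - (3 * cubic y) *\<^sub>R y) has_derivative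
      (\<lambda>v. B u v - ((3 * cubic u) *\<^sub>R v + (3 * (grad u \<bullet> v)) *\<^sub>R u))) (at u)"
    by (auto intro!: derivative_eq_intros)
  then have "sphere_hessian f u v =
      tangent_proj u (B u v - ((3 * cubic u) *\<^sub>R v + (3 * (grad u \<bullet> v)) *\<^sub>R u))"
    by (intro sphere_hessian_eqI[where G = "\<lambda>y. grad y - (3 * cubic y) *\<^sub>R y"])
       (use u v f sphere_grad_cubic in auto)
  also have "\<dots> = tangent_proj u (B u v) - (3 * cubic u) *\<^sub>R v"
    using u v by (simp add: tangent_proj_def inner_simps norm_eq_1 algebra_simps)
  finally show ?thesis
    using f[OF u] by (simp add: Q_op_def algebra_simps flip: scaleR_left_distrib)
qed

end

section \<open>Orthonormal frames, and why the determinant does not depend on them\<close>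

definition orthonormal_frame :: "real^4 \<Rightarrow> real^4^3 \<Rightarrow> bool" where
  "orthonormal_frame u e \<longleftrightarrow>
     (\<forall>i. (e $ i) \<bullet> u = 0) \<and> (\<forall>i j. (e $ i) \<bullet> (e $ j) = (if i = j then 1 else 0))"

text \<open>A nonzero remainder \<open>y\<close> would give, with \<open>u\<close> and the three
  frame vectors, five nonzero pairwise orthogonal vectors in dimension four.\<close>

lemma orthonormal_frame_expansion:
  assumes u: "norm u = 1" and e: "orthonormal_frame u e" and x: "x \<bullet> u = 0"
  shows "x = (\<Sum>i\<in>UNIV. ((e $ i) \<bullet> x) *\<^sub>R (e $ i))"
proof (rule ccontr)
  assume ne: "\<not> ?thesis"
  define y where "y = x - (\<Sum>i\<in>UNIV. ((e $ i) \<bullet> x) *\<^sub>R (e $ i))"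
  have eu: "(e $ i) \<bullet> u = 0" and ee: "(e $ i) \<bullet> (e $ j) = (if i = j then 1 else 0)" for i j
    using e by (auto simp: orthonormal_frame_def)
  have ye: "(e $ j) \<bullet> y = 0" for j
    by (simp add: y_def inner_simps inner_sum_right ee if_distrib cong: if_cong)
  have yu: "u \<bullet> y = 0"
    using x eu by (simp add: y_def inner_simps inner_sum_right inner_commute)
  have y0: "y \<noteq> 0"
    using ne by (simp add: y_def)
  have u0: "u \<noteq> 0" and e0: "e $ i \<noteq> 0" for i
    using u ee[of i i] by auto
  define S where "S = {u, y} \<union> range (\<lambda>i. e $ i)"
  have orth: "pairwise orthogonal S"
    unfolding S_def pairwise_def orthogonal_def
    using eu ee ye yu by (auto simp: inner_commute split: if_splits)
  have "0 \<notin> S"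
    using y0 u0 e0 by (auto simp: S_def) 
  with orth have "independent S"
    by (rule pairwise_orthogonal_independent)
  then have "card S \<le> 4"
    using independent_card_le[of S] by simp
  moreover have "card S = 5"
  proof -
    have inj: "inj (\<lambda>i. e $ i)"
      using ee by (metis (full_types) injI zero_neq_one)
    have "u \<notin> insert y (range (\<lambda>i. e $ i))"
      using u0 eu yu by (metis imageE inner_eq_zero_iff insertE)
    moreover have "y \<notin> range (\<lambda>i. e $ i)"
      using y0 ye by (metis imageE inner_eq_zero_iff)
    ultimately show ?thesis
      using card_image[OF inj] by (simp add: S_def)
  qed
  ultimately show False
    by simp
qed

text \<open>Left multiples by i, j, k of the quaternion with coordinates \<open>u$1\<close>, ...,
  \<open>u$4\<close>. The frame is linear in \<open>u\<close>.\<close>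

definition quaternion_frame :: "real^4 \<Rightarrow> real^4^3" where
  "quaternion_frame u = vector
     [vector [- u$2, u$1, - u$4, u$3], vector [- u$3, u$4, u$1, - u$2],
      vector [- u$4, - u$3, u$2, u$1]]"

lemma vector_4 [simp]:
  "(vector [a, b, c, d] :: 'a::zero^4) $ 1 = a" "(vector [a, b, c, d] :: 'a^4) $ 2 = b"
  "(vector [a, b, c, d] :: 'a^4) $ 3 = c" "(vector [a, b, c, d] :: 'a^4) $ 4 = d"
  by (simp_all add: vector_def)

lemma inner_real4: "(x::real^4) \<bullet> y = x$1 * y$1 + x$2 * y$2 + x$3 * y$3 + x$4 * y$4"
  by (simp add: inner_vec_def sum_4)

lemma sphere_real4: "norm (u::real^4) = 1 \<Longrightarrow> (u$1)\<^sup>2 + (u$2)\<^sup>2 + (u$3)\<^sup>2 + (u$4)\<^sup>2 = 1"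
  by (simp add: norm_eq_1 inner_real4 power2_eq_square)

lemma quaternion_frame_orthonormal:
  assumes "norm u = 1"
  shows "orthonormal_frame u (quaternion_frame u)"
  using sphere_real4[OF assms]
  by (simp add: orthonormal_frame_def quaternion_frame_def forall_3 inner_real4 vector_3 algebra_simps
      power2_eq_square)

lemma tangent_frame_orthonormal:
  assumes "norm u = 1"
  shows "orthonormal_frame u (tangent_frame u)"
  unfolding orthonormal_frame_def tangent_frame_def
  by (rule someI[where x = "quaternion_frame u"])
     (use quaternion_frame_orthonormal[OF assms] in \<open>auto simp: orthonormal_frame_def\<close>)

text \<open>The change between two frames is an orthogonal matrix \<open>R\<close>, so the matrix is
  conjugated and the determinant picks up \<open>det R * det R = 1\<close>. The operator
  \<open>A\<close> may be uncontrolled off the tangent space, hence the linear stand-in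
  \<open>L\<close>.\<close>

lemma tangent_det_eq:
  assumes u: "norm u = 1" and e: "orthonormal_frame u e" and L: "linear L"
    and A: "\<And>v. v \<bullet> u = 0 \<Longrightarrow> A v = L v"
  shows "tangent_det u A = det (\<chi> i j. (e $ i) \<bullet> L (e $ j))"
proof -
  define f where "f = tangent_frame u"
  have f: "orthonormal_frame u f"
    unfolding f_def by (rule tangent_frame_orthonormal[OF u])
  define R :: "real^3^3" where "R = (\<chi> i j. (f $ i) \<bullet> (e $ j))"
  define M :: "real^3^3" where "M = (\<chi> i j. (e $ i) \<bullet> L (e $ j))"
  have fu: "(f $ i) \<bullet> u = 0" for i
    using f by (auto simp: orthonormal_frame_def)
  have expand: "f $ i = (\<Sum>k\<in>UNIV. R $ i $ k *\<^sub>R (e $ k))" for i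
    using orthonormal_frame_expansion[OF u e fu[of i]] by (simp add: R_def inner_commute)
  have "(f $ i) \<bullet> A (f $ j) = (R ** M ** transpose R) $ i $ j" for i j
  proof -
    have "(f $ i) \<bullet> A (f $ j) = (f $ i) \<bullet> L (f $ j)"
      by (simp add: A fu)
    also have "L (f $ j) = (\<Sum>k\<in>UNIV. R $ j $ k *\<^sub>R L (e $ k))"
      unfolding expand[of j] by (simp add: linear_sum[OF L] linear_scale[OF L])
    also have "(f $ i) \<bullet> \<dots> = (\<Sum>k\<in>UNIV. \<Sum>l\<in>UNIV. R $ j $ k * (R $ i $ l * M $ l $ k))"
      unfolding expand[of i] by (simp add: inner_sum_left inner_sum_right sum_distrib_left M_def)
    finally show ?thesis
      by (simp add: matrix_matrix_mult_def transpose_def sum_distrib_right sum_distrib_left ac_simps)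
  qed
  then have "(\<chi> i j. (f $ i) \<bullet> A (f $ j)) = R ** M ** transpose R"
    by (simp add: vec_eq_iff)
  then have "tangent_det u A = det R * det R * det M"
    by (simp add: tangent_det_def det_mul f_def)
  also have "det R * det R = 1"
  proof -
    have "(R ** transpose R) $ i $ j = (mat 1 :: real^3^3) $ i $ j" for i j
    proof -
      have "(if i = j then 1 else 0) = (f $ i) \<bullet> (f $ j)"
        using f by (auto simp: orthonormal_frame_def)
      also have "\<dots> = (\<Sum>k\<in>UNIV. R $ j $ k * R $ i $ k)"
        by (subst (2) expand) (simp add: inner_sum_right R_def)
      finally show ?thesis
        by (simp add: matrix_matrix_mult_def transpose_def mat_def ac_simps)
    qed
    then have "R ** transpose R = mat 1"
      by (simp add: vec_eq_iff)
    from arg_cong[OF this, of det] show ?thesis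
      by (simp add: det_mul)
  qed
  finally show ?thesis
    by (simp add: M_def)
qed


section \<open>The two cubic forms and their tangential Hessians\<close>

lemma bounded_bilinear_vec4:
  fixes F :: "real^4 \<Rightarrow> real^4 \<Rightarrow> real^4"
  assumes "\<And>x y z. F (x + y) z = F x z + F y z" "\<And>c x z. F (c *\<^sub>R x) z = c *\<^sub>R F x z"
    "\<And>x y. F x y = F y x"
  shows "bounded_bilinear F"
proof -
  have "bilinear F"
    unfolding bilinear_def linear_iff using assms by metis
  then show ?thesis
    using bilinear_conv_bounded_bilinear by blast
qed

text \<open>
  The second derivatives of \<open>x\<^sub>1\<^sup>3 - x\<^sub>1 * |x|\<^sup>2 / 2\<close>, the homogeneous form of \<^const>\<open>q_minus\<close>, and of \<^const>\<open>q_plus\<close>.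
\<close>

definition B_minus :: "real^4 \<Rightarrow> real^4 \<Rightarrow> real^4" where
  "B_minus x v = (6 * x$1 * v$1 - x \<bullet> v) *\<^sub>R axis 1 1 - v$1 *\<^sub>R x - x$1 *\<^sub>R v"

definition B_plus :: "real^4 \<Rightarrow> real^4 \<Rightarrow> real^4" where
  "B_plus x v = vector
     [2 * (x$1 * v$3 + x$3 * v$1) - 2 * (x$2 * v$4 + x$4 * v$2),
      - 2 * (x$2 * v$3 + x$3 * v$2) - 2 * (x$1 * v$4 + x$4 * v$1),
      2 * (x$1 * v$1 - x$2 * v$2),
      - 2 * (x$1 * v$2 + x$2 * v$1)]"

lemma axis_nth_4 [simp]:
  "(axis 1 1 :: real^4) $ 1 = 1" "(axis 1 1 :: real^4) $ 2 = 0"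
  "(axis 1 1 :: real^4) $ 3 = 0" "(axis 1 1 :: real^4) $ 4 = 0"
  "(axis 2 1 :: real^4) $ 1 = 0" "(axis 2 1 :: real^4) $ 2 = 1"
  "(axis 2 1 :: real^4) $ 3 = 0" "(axis 2 1 :: real^4) $ 4 = 0"
  "(axis 3 1 :: real^4) $ 1 = 0" "(axis 3 1 :: real^4) $ 2 = 0"
  "(axis 3 1 :: real^4) $ 3 = 1" "(axis 3 1 :: real^4) $ 4 = 0"
  "(axis 4 1 :: real^4) $ 1 = 0" "(axis 4 1 :: real^4) $ 2 = 0"
  "(axis 4 1 :: real^4) $ 3 = 0" "(axis 4 1 :: real^4) $ 4 = 1"
  by (simp_all add: axis_def)

interpretation minus: symmetric_trilinear B_minus
proof (rule symmetric_trilinear.intro)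
  show "bounded_bilinear B_minus"
    by (rule bounded_bilinear_vec4) (simp_all add: B_minus_def vec_eq_iff forall_4 inner_real4 algebra_simps)
qed (simp_all add: B_minus_def vec_eq_iff forall_4 inner_real4 algebra_simps)

interpretation plus: symmetric_trilinear B_plus
proof (rule symmetric_trilinear.intro)
  show "bounded_bilinear B_plus"
    by (rule bounded_bilinear_vec4) (simp_all add: B_plus_def vec_eq_iff forall_4 algebra_simps)
qed (simp_all add: B_plus_def vec_eq_iff forall_4 inner_real4 algebra_simps)

lemma minus_cubic: "minus.cubic x = (x$1) ^ 3 - x$1 * (x \<bullet> x) / 2"
  by (simp add: minus.cubic_def B_minus_def inner_real4 field_simps power3_eq_cube)

lemma plus_cubic: "plus.cubic x = q_plus x"
  by (simp add: plus.cubic_def B_plus_def inner_real4 q_plus_def field_simps power2_eq_square)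

lemma q_minus_eq_cubic: "norm u = 1 \<Longrightarrow> q_minus u = minus.cubic u"
  by (simp add: minus_cubic q_minus_def norm_eq_1)

lemma q_plus_eq_cubic: "q_plus u = plus.cubic u"
  by (simp add: plus_cubic)

lemma sum_Basis_real4: "(\<Sum>b\<in>(Basis :: (real^4) set). f b) = (\<Sum>i\<in>UNIV. f (axis i 1))"
proof -
  have "inj (\<lambda>i::4. axis i (1::real))"
    by (simp add: inj_def axis_eq_axis)
  moreover have "(Basis :: (real^4) set) = range (\<lambda>i. axis i 1)"
    by (auto simp: Basis_vec_def)
  ultimately show ?thesis
    by (metis (mono_tags, lifting) sum.reindex_cong)
qed

lemma laplacian_minus: "laplacian minus.cubic x = 0"
  unfolding minus.laplacian_cubic sum_Basis_real4
  by (simp add: sum_4 B_minus_def inner_real4 algebra_simps)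

lemma laplacian_plus: "laplacian plus.cubic x = 0"
  unfolding plus.laplacian_cubic sum_Basis_real4
  by (simp add: sum_4 B_plus_def inner_real4 algebra_simps)

lemma real_polynomial_function_nth: "real_polynomial_function (\<lambda>x::real^'n. x $ i)"
  by (rule real_polynomial_function.intros(1)) (rule bounded_linear_vec_nth)

lemmas real_polynomial_function_intros =
  real_polynomial_function.intros(2-4)
  real_polynomial_function_diff real_polynomial_function_power real_polynomial_function_nth

lemma spherical_harmonic_q_minus: "spherical_harmonic 3 q_minus"
proof -
  have "real_polynomial_function (\<lambda>x::real^4. (x$1) ^ 3
          - x$1 * ((x$1 * x$1 + x$2 * x$2 + x$3 * x$3 + x$4 * x$4) * (1 / 2)))"
    by (intro real_polynomial_function_intros)
  then have "real_polynomial_function minus.cubic"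
    by (rule back_subst[where P = real_polynomial_function]) (simp add: fun_eq_iff minus_cubic inner_real4)
  then show ?thesis
    unfolding spherical_harmonic_def
    by (intro exI[of _ minus.cubic]) (simp add: minus.cubic_scale laplacian_minus q_minus_eq_cubic)
qed

lemma spherical_harmonic_q_plus: "spherical_harmonic 3 q_plus"
proof -
  have "plus.cubic = q_plus"
    by (simp add: fun_eq_iff plus_cubic)
  moreover have "real_polynomial_function q_plus"
    unfolding q_plus_def by (intro real_polynomial_function_intros)
  ultimately show ?thesis
    unfolding spherical_harmonic_def
    using plus.cubic_scale laplacian_plus by (intro exI[of _ q_plus]) simp
qed

text \<open>The subtracted term \<open>(B u u \<bullet> u) / 3\<close> is twice the cubic form.\<close>

definition Q_matrix :: "(real^4 \<Rightarrow> real^4 \<Rightarrow> real^4) \<Rightarrow> real^4 \<Rightarrow> real^3^3" where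
  "Q_matrix B u = (\<chi> i j. (quaternion_frame u $ i) \<bullet> B u (quaternion_frame u $ j)
     - (if i = j then (B u u \<bullet> u) / 3 else 0))"

text \<open>On tangent vectors \<open>Q_op\<close> of the constant 1 is the identity, so every
  determinant in the two polarization sums below is of a combination of this kind.\<close>

lemma tangent_det_Q_op:
  fixes B :: "real^4 \<Rightarrow> real^4 \<Rightarrow> real^4"
  assumes "symmetric_trilinear B"
    and f: "\<And>y. norm y = 1 \<Longrightarrow> f y = symmetric_trilinear.cubic B y" and u: "norm u = 1"
    and A: "\<And>v. v \<bullet> u = 0 \<Longrightarrow> A v = a *\<^sub>R Q_op f u v + b *\<^sub>R v"
  shows "tangent_det u A = det (\<chi> i j. a * Q_matrix B u $ i $ j + (if i = j then b else 0))"
proof -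
  interpret symmetric_trilinear B by fact
  define L where "L v = a *\<^sub>R (tangent_proj u (B u v) - (2 * cubic u) *\<^sub>R v) + b *\<^sub>R v" for v
  have e: "orthonormal_frame u (quaternion_frame u)"
    by (rule quaternion_frame_orthonormal[OF u])
  have "linear L"
    by (rule linearI)
       (simp_all add: L_def tangent_proj_def B.add_right B.scaleR_right inner_simps algebra_simps)
  then have "tangent_det u A
      = det (\<chi> i j. (quaternion_frame u $ i) \<bullet> L (quaternion_frame u $ j))"
    by (rule tangent_det_eq[OF u e]) (use A f u in \<open>auto simp: L_def Q_op_cubic\<close>)
  moreover have "(quaternion_frame u $ i) \<bullet> L (quaternion_frame u $ j)
      = a * Q_matrix B u $ i $ j + (if i = j then b else 0)" for i j
    using e by (simp add: L_def Q_matrix_def orthonormal_frame_def tangent_proj_def inner_simps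
        cubic_def algebra_simps)
  ultimately show ?thesis
    by simp
qed

lemma mixed_discriminant_Q_op_diag:
  fixes B :: "real^4 \<Rightarrow> real^4 \<Rightarrow> real^4"
  assumes "symmetric_trilinear B"
    and "\<And>y. norm y = 1 \<Longrightarrow> f y = symmetric_trilinear.cubic B y" and "norm u = 1"
  shows "mixed_discriminant u (Q_op f u) (Q_op f u) (Q_op f u) = det (Q_matrix B u)"
proof -
  note * = tangent_det_Q_op[OF assms]
  have 1: "tangent_det u (Q_op f u) = det (Q_matrix B u)"
    using *[of _ 1 0] by (simp add: vec_lambda_eta cong: if_cong)
  have 2: "tangent_det u (\<lambda>v. Q_op f u v + Q_op f u v) = 8 * det (Q_matrix B u)"
    by (subst *[of _ 2 0]) (simp_all add: scaleR_2 det_3 algebra_simps)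
  have three: "3 *\<^sub>R x = x + x + x" for x :: "real^4"
    using scaleR_left_distrib[of 2 1 x] by (simp add: scaleR_2)
  have 3: "tangent_det u (\<lambda>v. Q_op f u v + Q_op f u v + Q_op f u v) = 27 * det (Q_matrix B u)"
    by (subst *[of _ 3 0]) (simp_all add: three det_3 algebra_simps)
  \<comment> \<open>The polarization sum is \<open>(27 - 3 * 8 + 3) / 6 = 1\<close> times the
    determinant.\<close>
  show ?thesis
    unfolding mixed_discriminant_def 1 2 3 by simp
qed

text \<open>The linear coefficient of det(I + tA) is the trace of A, and by trilinearity it is three
  times the mixed discriminant of A, I, I.\<close>

lemma mixed_discriminant_Q_op_one:
  fixes B :: "real^4 \<Rightarrow> real^4 \<Rightarrow> real^4"
  assumes "symmetric_trilinear B"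
    and "\<And>y. norm y = 1 \<Longrightarrow> f y = symmetric_trilinear.cubic B y" and "norm u = 1"
  shows "mixed_discriminant u (Q_op f u) (Q_op (\<lambda>_. 1) u) (Q_op (\<lambda>_. 1) u) = trace (Q_matrix B u) / 3"
proof -
  have *: "tangent_det u A = det (\<chi> i j. a * Q_matrix B u $ i $ j + (if i = j then b else 0))"
    if "\<And>v. v \<bullet> u = 0 \<Longrightarrow> A v = a *\<^sub>R Q_op f u v + b *\<^sub>R v" for A a b
    by (rule tangent_det_Q_op[OF assms that])
  have one: "Q_op (\<lambda>_. 1) u v = v" if "v \<bullet> u = 0" for v
    using Q_op_const[OF assms(3) that, of 1] by simp
  have "tangent_det u (\<lambda>v. Q_op f u v + Q_op (\<lambda>_. 1) u v + Q_op (\<lambda>_. 1) u v)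
      = det (\<chi> i j. 1 * Q_matrix B u $ i $ j + (if i = j then 2 else 0))"
    by (rule *) (simp add: one scaleR_2)
  moreover have "tangent_det u (\<lambda>v. Q_op f u v + Q_op (\<lambda>_. 1) u v)
      = det (\<chi> i j. 1 * Q_matrix B u $ i $ j + (if i = j then 1 else 0))"
    by (rule *) (simp add: one)
  moreover have "tangent_det u (\<lambda>v. Q_op (\<lambda>_. 1) u v + Q_op (\<lambda>_. 1) u v)
      = det (\<chi> i j. 0 * Q_matrix B u $ i $ j + (if i = j then 2 else 0))"
    by (rule *) (simp add: one scaleR_2)
  moreover have "tangent_det u (Q_op f u)
      = det (\<chi> i j. 1 * Q_matrix B u $ i $ j + (if i = j then 0 else 0))"
    by (rule *) simp
  moreover have "tangent_det u (Q_op (\<lambda>_. 1) u)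
      = det (\<chi> i j. 0 * Q_matrix B u $ i $ j + (if i = j then 1 else 0))"
    by (rule *) (simp add: one)
  ultimately show ?thesis
    unfolding mixed_discriminant_def
    by (simp add: det_3 trace_def sum_3 algebra_simps)
qed

section \<open>Trace and determinant of the tangential operator for the two harmonics\<close>

lemma Q_matrix_scale:
  "Q_matrix (\<lambda>x y. c *\<^sub>R B x y) u $ i $ j = c * Q_matrix B u $ i $ j"
  by (simp add: Q_matrix_def algebra_simps)

text \<open>Orthogonality to \<open>u\<close> removes most of \<open>B_minus\<close>, and its
  remaining \<open>- u$1\<close> on the diagonal cancels against the linear term of twice the cubic
  form. What is left is a rank-one matrix plus a multiple of the identity.\<close>

lemma Q_matrix_minus:
  assumes "norm u = 1"
  shows "Q_matrix B_minus u = (\<chi> i j. 6 * u$1 * (quaternion_frame u $ i $ 1) * (quaternion_frame u $ j $ 1)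
    - (if i = j then 2 * (u$1) ^ 3 else 0))"
proof -
  have e: "(quaternion_frame u $ i) \<bullet> u = 0"
    "(quaternion_frame u $ i) \<bullet> (quaternion_frame u $ j) = (if i = j then 1 else 0)" for i j
    using quaternion_frame_orthonormal[OF assms] by (auto simp: orthonormal_frame_def)
  have uu: "u \<bullet> u = 1"
    using assms by (simp add: norm_eq_1)
  have e': "u \<bullet> (quaternion_frame u $ i) = 0" for i
    using e(1)[of i] by (simp add: inner_commute)
  have ax: "x \<bullet> axis 1 1 = x $ 1" "axis 1 1 \<bullet> x = x $ 1" for x :: "real^4"
    by (simp_all add: inner_axis inner_axis')
  have B: "(quaternion_frame u $ i) \<bullet> B_minus u (quaternion_frame u $ j)
      = 6 * u$1 * (quaternion_frame u $ i $ 1) * (quaternion_frame u $ j $ 1) - (if i = j then u$1 else 0)" for i j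
    by (simp add: B_minus_def inner_simps ax e e')
  have Bu: "(B_minus u u \<bullet> u) / 3 = 2 * (u$1) ^ 3 - u$1"
    using minus.cubic_def[of u] minus_cubic[of u] uu by simp
  show ?thesis
    by (simp add: vec_eq_iff Q_matrix_def B Bu)
qed

lemma det_Q_matrix_minus:
  assumes "norm u = 1"
  shows "det (Q_matrix B_minus u) = 24 * (u$1) ^ 7 - 32 * (u$1) ^ 9"
proof -
  have eq: "(u$4)\<^sup>2 = 1 - (u$1)\<^sup>2 - (u$2)\<^sup>2 - (u$3)\<^sup>2"
    using sphere_real4[OF assms] by simp
  \<comment> \<open>For a multiple of the identity plus rank one, two eigenvalues are
    \<open>- 2 * (u$1) ^ 3\<close>; the third involves the squared length of the first coordinates
    of the frame.\<close>
  have "det (Q_matrix B_minus u)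
      = 4 * (u$1) ^ 6 * (6 * u$1 * ((u$2)\<^sup>2 + (u$3)\<^sup>2 + (u$4)\<^sup>2) - 2 * (u$1) ^ 3)"
    unfolding Q_matrix_minus[OF assms]
    by (simp add: det_3 quaternion_frame_def vector_3) algebra
  also have "\<dots> = 24 * (u$1) ^ 7 - 32 * (u$1) ^ 9"
    unfolding eq by algebra
  finally show ?thesis .
qed


text \<open>Conceptually, the trace of Q is the spherical Laplacian plus 3, and the Laplacian of the
  3-sphere acts on harmonics of degree three as -15. The proof is direct computation.\<close>

lemma trace_Q_matrix_minus:
  assumes "norm u = 1"
  shows "trace (Q_matrix B_minus u) = - 12 * q_minus u"
proof -
  have eq: "(u$2)\<^sup>2 + (u$3)\<^sup>2 + (u$4)\<^sup>2 = 1 - (u$1)\<^sup>2"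
    using sphere_real4[OF assms] by simp
  have "trace (Q_matrix B_minus u) = 6 * u$1 * ((u$2)\<^sup>2 + (u$3)\<^sup>2 + (u$4)\<^sup>2) - 6 * (u$1) ^ 3"
    unfolding Q_matrix_minus[OF assms]
    by (simp add: trace_def sum_3 quaternion_frame_def algebra_simps power2_eq_square)
  also have "\<dots> = - 12 * q_minus u"
    unfolding eq q_minus_def by (simp add: algebra_simps power2_eq_square power3_eq_cube)
  finally show ?thesis .
qed

text \<open>With z = u1 + i u2 and w = u3 + i u4, \<open>q_plus u\<close> is the real part of z^2 w,
  and \<open>L\<close>, \<open>K\<close> are the squared moduli of z and w.\<close>

lemma Q_matrix_plus:
  fixes u :: "real^4"
  defines "L \<equiv> (u$1)\<^sup>2 + (u$2)\<^sup>2" and "K \<equiv> (u$3)\<^sup>2 + (u$4)\<^sup>2"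
  shows "Q_matrix B_plus u = vector
    [vector [- 8 * q_plus u, u$2 * (4 * K - 2 * L), u$1 * (4 * K - 2 * L)],
     vector [u$2 * (4 * K - 2 * L), - 2 * q_plus u + u$3 * (2 * K - 4 * L), u$4 * (2 * K - 4 * L)],
     vector [u$1 * (4 * K - 2 * L), u$4 * (2 * K - 4 * L), - 2 * q_plus u - u$3 * (2 * K - 4 * L)]]"
proof -
  have *: "(B_plus u u \<bullet> u) / 3 = 2 * q_plus u"
    using plus.cubic_def[of u] plus_cubic[of u] by simp
  show ?thesis
    by (simp add: vec_eq_iff forall_3 Q_matrix_def *)
       (simp add: quaternion_frame_def B_plus_def inner_real4
        q_plus_def L_def K_def algebra_simps power2_eq_square)
qed

lemma det_Q_matrix_plus:
  assumes "norm u = 1"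
  shows "det (Q_matrix B_plus u) = 24 * ((u$1)\<^sup>2 + (u$2)\<^sup>2)\<^sup>2 * q_plus u - 32 * q_plus u ^ 3"
proof -
  define L where "L = (u$1)\<^sup>2 + (u$2)\<^sup>2"
  define K where "K = (u$3)\<^sup>2 + (u$4)\<^sup>2"
  define \<alpha> where "\<alpha> = 4 * K - 2 * L"
  define \<beta> where "\<beta> = 2 * K - 4 * L"
  have K: "K = 1 - L"
    using sphere_real4[OF assms] by (simp add: K_def L_def)
  have "det (Q_matrix B_plus u) = - 32 * q_plus u ^ 3 + 8 * q_plus u * \<beta>\<^sup>2 * ((u$3)\<^sup>2 + (u$4)\<^sup>2)
      + 2 * q_plus u * \<alpha>\<^sup>2 * ((u$1)\<^sup>2 + (u$2)\<^sup>2)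
      - \<alpha>\<^sup>2 * \<beta> * (((u$1)\<^sup>2 - (u$2)\<^sup>2) * u$3 - 2 * u$1 * u$2 * u$4)"
    unfolding Q_matrix_plus[of u, folded L_def K_def, folded \<alpha>_def \<beta>_def]
    by (simp add: det_3 algebra_simps power2_eq_square power3_eq_cube)
  \<comment> \<open>The coefficient of \<open>\<alpha>\<^sup>2 * \<beta>\<close> is, up to sign,
    \<open>q_plus u\<close> itself, so \<open>q_plus u\<close> factors out of the whole determinant;
    with \<open>K = 1 - L\<close> the remaining bracket collapses to a single term.\<close>
  also have "\<dots> = - 32 * q_plus u ^ 3 + q_plus u * (8 * \<beta>\<^sup>2 * K + 2 * \<alpha>\<^sup>2 * L - \<alpha>\<^sup>2 * \<beta>)"
    unfolding q_plus_def[symmetric] K_def[symmetric] L_def[symmetric] by (simp add: algebra_simps)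
  also have "8 * \<beta>\<^sup>2 * K + 2 * \<alpha>\<^sup>2 * L - \<alpha>\<^sup>2 * \<beta> = 24 * L\<^sup>2"
    unfolding \<alpha>_def \<beta>_def K by (simp add: algebra_simps power2_eq_square)
  finally show ?thesis
    by (simp add: L_def)
qed

lemma trace_Q_matrix_plus: "trace (Q_matrix B_plus u) = - 12 * q_plus u"
  by (simp add: Q_matrix_plus trace_def sum_3 vector_3)


section \<open>Polar coordinates and Gaussian integrals\<close>

lemma scale_measure_eq_density: "scale_measure c M = density M (\<lambda>_. c)"
proof (rule measure_eqI)
  fix A assume "A \<in> sets (scale_measure c M)"
  then show "emeasure (scale_measure c M) A = emeasure (density M (\<lambda>_. c)) A"
    by (simp add: emeasure_density nn_integral_cmult_indicator)
qed simp

lemma space_sphere_measure: "space (sphere_measure :: 'a::euclidean_space measure) = sphere 0 1"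
  by (simp add: sphere_measure_def space_scale_measure space_restrict_space)

lemma sgn_measurable_sphere:
  "sgn \<in> measurable (restrict_space lborel (ball 0 1 - {0})) (restrict_space borel (sphere (0::'a::euclidean_space) 1))"
proof (rule measurable_restrict_space2)
  show "sgn \<in> space (restrict_space lborel (ball 0 1 - {0})) \<rightarrow> sphere (0::'a) 1"
    by (auto simp: space_restrict_space norm_sgn)
  have "sgn \<in> borel_measurable (borel :: 'a measure)"
    unfolding sgn_div_norm by measurable
  then show "sgn \<in> borel_measurable (restrict_space lborel (ball (0::'a) 1 - {0}))"
    by (intro measurable_restrict_space1) simp
qed

lemma
  fixes f :: "'a::euclidean_space \<Rightarrow> real"
  assumes [measurable]: "f \<in> borel_measurable borel"
  shows integrable_sphere_measure:
      "integrable sphere_measure f \<longleftrightarrow>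
        integrable lborel (\<lambda>x. indicator (ball 0 1 - {0}) x * f (sgn x))"
    and integral_sphere_measure:
      "(LINT u|sphere_measure. f u) = DIM('a) * (LINT x|lborel. indicator (ball 0 1 - {0}) x * f (sgn x))"
proof -
  let ?R = "restrict_space lborel (ball (0::'a) 1 - {0})"
  let ?S = "distr ?R (restrict_space borel (sphere (0::'a) 1)) sgn"
  have eq: "sphere_measure = density ?S (\<lambda>_. ennreal (real DIM('a)))"
    unfolding sphere_measure_def scale_measure_eq_density by (simp add: ennreal_of_nat_eq_real_of_nat)
  have f: "f \<in> borel_measurable (restrict_space borel (sphere 0 1))"
    by (intro measurable_restrict_space1) simp
  then have fS: "f \<in> borel_measurable ?S"
    by simp
  have meas: "ball (0::'a) 1 - {0} \<inter> space lborel \<in> sets lborel"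
    by simp
  have "integrable sphere_measure f \<longleftrightarrow> integrable ?S (\<lambda>x. real DIM('a) *\<^sub>R f x)"
    unfolding eq by (rule integrable_density) (use fS in auto)
  also have "\<dots> \<longleftrightarrow> integrable ?S f"
    by simp
  also have "\<dots> \<longleftrightarrow> integrable ?R (\<lambda>x. f (sgn x))"
    by (rule integrable_distr_eq[OF sgn_measurable_sphere f])
  also have "\<dots> \<longleftrightarrow> integrable lborel (\<lambda>x. indicator (ball 0 1 - {0}) x * f (sgn x))"
    by (subst integrable_restrict_space) auto
  finally show "integrable sphere_measure f \<longleftrightarrow>
        integrable lborel (\<lambda>x. indicator (ball 0 1 - {0}) x * f (sgn x))" .
  have "(LINT u|sphere_measure. f u) = (LINT x|?S. real DIM('a) *\<^sub>R f x)"
    unfolding eq by (rule integral_density) (use fS in auto)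
  also have "\<dots> = DIM('a) * (LINT x|?S. f x)"
    by simp
  also have "(LINT x|?S. f x) = (LINT x|?R. f (sgn x))"
    by (rule integral_distr[OF sgn_measurable_sphere f])
  also have "\<dots> = (LINT x|lborel. indicator (ball 0 1 - {0}) x * f (sgn x))"
    by (subst integral_restrict_space) auto
  finally show "(LINT u|sphere_measure. f u) = DIM('a) * (LINT x|lborel. indicator (ball 0 1 - {0}) x * f (sgn x))" .
qed

lemma integral_lborel_scale:
  fixes g :: "'a::euclidean_space \<Rightarrow> real"
  assumes [measurable]: "g \<in> borel_measurable borel" and "c > 0"
  shows "(LINT x|lborel. g x) = c ^ DIM('a) * (LINT x|lborel. g (c *\<^sub>R x))"
proof -
  have "(LINT x|lborel. g x)
      = (LINT x|density (distr lborel borel (\<lambda>x. 0 + c *\<^sub>R x)) (\<lambda>_. ennreal (\<bar>c\<bar> ^ DIM('a))). g x)"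
    using lborel_affine[of c "0::'a"] assms(2) by simp
  also have "\<dots> = (LINT x|distr lborel borel (\<lambda>x. 0 + c *\<^sub>R x). \<bar>c\<bar> ^ DIM('a) *\<^sub>R g x)"
    by (rule integral_density) auto
  also have "\<dots> = c ^ DIM('a) * (LINT x|distr lborel borel (\<lambda>x. 0 + c *\<^sub>R x). g x)"
    using assms(2) by simp
  also have "(LINT x|distr lborel borel (\<lambda>x. 0 + c *\<^sub>R x). g x) = (LINT x|lborel. g (0 + c *\<^sub>R x))"
    by (rule integral_distr) auto
  finally show ?thesis
    by simp
qed

text \<open>This scaling law takes the place of polar coordinates: \<open>f (sgn x)\<close> is
  constant along rays, so only the volume scales.\<close>

lemma integral_punctured_ball_scale:
  fixes f :: "'a::euclidean_space \<Rightarrow> real"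
  assumes [measurable]: "f \<in> borel_measurable borel" and s: "s > 0"
  shows "(LINT x|lborel. indicator {x. 0 < norm x \<and> norm x < s} x * f (sgn x))
    = s ^ DIM('a) * (LINT x|lborel. indicator {x. 0 < norm x \<and> norm x < 1} x * f (sgn x))"
proof -
  have [measurable]: "sgn \<in> borel_measurable (borel :: 'a measure)"
    unfolding sgn_div_norm by measurable
  have *: "indicator {x. 0 < norm x \<and> norm x < s} (s *\<^sub>R x) * f (sgn (s *\<^sub>R x))
      = indicator {x. 0 < norm x \<and> norm x < 1} x * f (sgn x)" for x :: 'a
    using s by (simp add: sgn_scaleR indicator_def)
  have [measurable]: "{x::'a. 0 < norm x \<and> norm x < s} \<in> sets borel"
    by measurable
  have "(\<lambda>x::'a. indicator {x. 0 < norm x \<and> norm x < s} x * f (sgn x)) \<in> borel_measurable borel"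
    by measurable
  from integral_lborel_scale[OF this s] show ?thesis
    unfolding * .
qed

section \<open>Radial Gaussian integrals and their link to the sphere\<close>

lemma half_gaussian_integrable:
  "integrable lborel (\<lambda>x::real. indicator {0..} x * (exp (- x\<^sup>2) * x ^ j))"
proof (cases "even j")
  case True
  then obtain k where "j = 2 * k" by blast
  with gaussian_moment_even_pos[of k] show ?thesis
    by (simp only: has_bochner_integral_iff real_scaleR_def)
next
  case False
  then obtain k where "j = 2 * k + 1"
    using oddE by blast
  with gaussian_moment_odd_pos[of k] show ?thesis
    by (simp only: has_bochner_integral_iff real_scaleR_def)
qed

lemma half_gaussian_odd:
  "(LINT x|lborel. indicator {0..} x * (exp (- x\<^sup>2) * x ^ (2 * k + 1))) = fact k / (2::real)"
  using gaussian_moment_odd_pos[of k] by (simp only: has_bochner_integral_iff real_scaleR_def)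

text \<open>Minus the derivative of \<open>s ^ k * exp (- s\<^sup>2)\<close>.\<close>

definition radial_density :: "nat \<Rightarrow> real \<Rightarrow> real" where
  "radial_density k s = (2 * s ^ (k + 1) - k * s ^ (k - 1)) * exp (- s\<^sup>2)"

lemma radial_density_measurable [measurable]: "radial_density k \<in> borel_measurable borel"
  unfolding radial_density_def[abs_def] by (intro borel_measurable_continuous_onI continuous_intros)

lemma radial_density_integrable:
  "integrable lborel (\<lambda>s. indicator {0..} s * (radial_density k s * s ^ j))"
proof -
  have "(\<lambda>s::real. indicator {0..} s * (radial_density k s * s ^ j))
    = (\<lambda>s. 2 * (indicator {0..} s * (exp (- s\<^sup>2) * s ^ (k + 1 + j)))
         - k * (indicator {0..} s * (exp (- s\<^sup>2) * s ^ (k - 1 + j))))"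
    by (simp add: fun_eq_iff radial_density_def power_add algebra_simps)
  then show ?thesis
    by (simp only: Bochner_Integration.integrable_diff integrable_mult_right half_gaussian_integrable)
qed

lemma radial_density_integral:
  "(LINT s|lborel. indicator {0..} s * (radial_density (2 * m) s * s ^ 4)) = 2 * fact (m + 1)"
proof -
  have "(\<lambda>s::real. indicator {0..} s * (radial_density (2 * m) s * s ^ 4))
    = (\<lambda>s. 2 * (indicator {0..} s * (exp (- s\<^sup>2) * s ^ (2 * (m + 2) + 1)))
         - 2 * m * (indicator {0..} s * (exp (- s\<^sup>2) * s ^ (2 * (m + 1) + 1))))"
  \<comment> \<open>For \<open>m = 0\<close> the exponent \<open>k - 1\<close> is truncated to 0,
    but its coefficient \<open>k\<close> vanishes; otherwise the exponents add up as
    displayed.\<close>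
  proof (cases m)
    case (Suc n)
    then show ?thesis
      by (simp add: fun_eq_iff radial_density_def power_add algebra_simps power_numeral_reduce)
  qed (simp add: fun_eq_iff radial_density_def power_numeral_reduce)
  then have "(LINT s|lborel. indicator {0..} s * (radial_density (2 * m) s * s ^ 4))
      = 2 * (fact (m + 2) / 2) - 2 * m * (fact (m + 1) / 2)"
    by (simp only: Bochner_Integration.integral_diff integrable_mult_right half_gaussian_integrable
        integral_mult_right_zero half_gaussian_odd)
  moreover have "2 * (fact (m + 2) / 2) - 2 * m * (fact (m + 1) / 2) = (2 * fact (m + 1) :: real)"
    by (simp add: algebra_simps)
  ultimately show ?thesis
    by (simp only:)
qed

lemma power_times_gaussian_tendsto_0: "((\<lambda>s::real. s ^ k * exp (- s\<^sup>2)) \<longlongrightarrow> 0) at_top"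
proof (rule real_tendsto_sandwich[OF _ _ tendsto_const])
  show "\<forall>\<^sub>F s::real in at_top. 0 \<le> s ^ k * exp (- s\<^sup>2)"
    by (rule eventually_mono[OF eventually_ge_at_top[of 0]]) simp
  show "\<forall>\<^sub>F s::real in at_top. s ^ k * exp (- s\<^sup>2) \<le> s ^ k / exp s"
    using eventually_ge_at_top[of "1::real"]
  proof eventually_elim
    case (elim s)
    then have "exp (- s\<^sup>2) \<le> exp (- s)"
      by (simp add: power2_eq_square)
    with elim show ?case
      by (simp add: divide_inverse exp_minus mult_left_mono)
  qed
  show "((\<lambda>s::real. s ^ k / exp s) \<longlongrightarrow> 0) at_top"
    by (rule tendsto_power_div_exp_0)
qed

lemma radial_density_tail:
  assumes r: "r > 0"
  shows "(LINT s|lborel. indicator {r<..} s * radial_density k s) = r ^ k * exp (- r\<^sup>2)"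
proof -
  let ?F = "\<lambda>s::real. - (s ^ k * exp (- s\<^sup>2))"
  have deriv: "(?F has_vector_derivative radial_density k s) (at s)" for s
    unfolding radial_density_def has_real_derivative_iff_has_vector_derivative[symmetric]
    by (auto intro!: derivative_eq_intros simp: algebra_simps)
  have "(LBINT s=ereal r..\<infinity>. radial_density k s) = 0 - ?F r"
  proof (rule interval_integral_FTC_integrable[where F = ?F])
    show "set_integrable lborel (einterval (ereal r) \<infinity>) (radial_density k)"
    proof -
      have "integrable lborel (\<lambda>s. indicator {r<..} s *\<^sub>R (indicator {0..} s * (radial_density k s * s ^ 0)))"
        by (rule integrable_mult_indicator) (use radial_density_integrable[of k 0] in auto)
      moreover have "(\<lambda>s. indicator {r<..} s *\<^sub>R (indicator {0..} s * (radial_density k s * s ^ 0)))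
          = (\<lambda>s. indicator {r<..} s *\<^sub>R radial_density k s)"
        using r by (auto simp: fun_eq_iff indicator_def)
      ultimately show ?thesis
        by (simp add: set_integrable_def)
    qed
    show "((?F \<circ> real_of_ereal) \<longlongrightarrow> ?F r) (at_right (ereal r))"
      unfolding ereal_tendsto_simps by (auto intro!: tendsto_eq_intros)
    show "((?F \<circ> real_of_ereal) \<longlongrightarrow> 0) (at_left \<infinity>)"
      unfolding ereal_tendsto_simps using tendsto_minus[OF power_times_gaussian_tendsto_0[of k]] by simp
  qed (use deriv in \<open>auto simp: radial_density_def[abs_def] intro!: continuous_intros\<close>)
  then show ?thesis
    by (simp add: interval_lebesgue_integral_def set_lebesgue_integral_def)
qed

text \<open>A layer-cake argument. By \<open>radial_density_tail\<close> the radial factor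
  \<open>norm x ^ (2 * m) * exp (- (norm x)\<^sup>2)\<close> is the integral of
  \<open>radial_density (2 * m) s\<close> over \<open>s > norm x\<close>. Exchanging the integrals
  leaves, for each \<open>s\<close>, the integral of \<open>f (sgn x)\<close> over a punctured ball,
  which is \<open>s ^ 4 * I\<close>; the sphere integral is \<open>4 * I\<close>.\<close>

lemma gaussian_integral_homogeneous:
  fixes f :: "real^4 \<Rightarrow> real"
  assumes f [measurable]: "f \<in> borel_measurable borel"
    and hom: "\<And>t x. t > 0 \<Longrightarrow> f (t *\<^sub>R x) = t ^ (2 * m) * f x"
    and bound: "\<And>u. norm u = 1 \<Longrightarrow> \<bar>f u\<bar> \<le> C"
  shows "integrable sphere_measure f"
    and "(LINT x|lborel. f x * exp (- (norm x)\<^sup>2)) = fact (m + 1) / 2 * (LINT u|sphere_measure. f u)"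
proof -
  have [measurable]: "sgn \<in> borel_measurable (borel :: (real^4) measure)"
    unfolding sgn_div_norm by measurable
  define D :: "real \<Rightarrow> (real^4) set" where "D s = {x. 0 < norm x \<and> norm x < s}" for s
  have [measurable]: "D s \<in> sets borel" for s
    unfolding D_def by measurable
  have D1: "D 1 = ball 0 1 - {0}"
    by (auto simp: D_def)
  have int: "integrable lborel (\<lambda>x. indicator (D s) x * f (sgn x))" for s
  proof (rule Bochner_Integration.integrable_bound)
    show "integrable lborel (\<lambda>x. C * indicator (D s) x :: real)"
    proof -
      have "emeasure lborel (D s) \<le> emeasure lborel (ball (0::real^4) s)"
        by (rule emeasure_mono) (auto simp: D_def)
      also have "\<dots> < \<infinity>"
        using emeasure_bounded_finite[OF bounded_ball[of "0::real^4" s]] by simp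
      finally show ?thesis
        by (intro integrable_mult_right integrable_real_indicator) auto
    qed
    show "AE x in lborel. norm (indicator (D s) x * f (sgn x)) \<le> norm (C * indicator (D s) x)"
    proof (rule AE_I2)
      fix x
      show "norm (indicator (D s) x * f (sgn x)) \<le> norm (C * indicator (D s) x)"
      proof (cases "x \<in> D s")
        case True
        then have "norm (sgn x) = 1"
          by (simp add: D_def norm_sgn)
        with bound[of "sgn x"] True show ?thesis
          by simp
      qed simp
    qed
  qed measurable
  show intS: "integrable sphere_measure f"
    unfolding integrable_sphere_measure[OF f] using int[of 1] by (simp add: D1)
  define I where "I = (LINT x|lborel. indicator (D 1) x * f (sgn x))"
  define J where "J = (LINT x|lborel. indicator (D 1) x * \<bar>f (sgn x)\<bar>)"
  define v where "v s = indicator {0..} s * radial_density (2 * m) s" for s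
  have [measurable]: "v \<in> borel_measurable borel"
    unfolding v_def by measurable
  define h where "h s x = v s * (indicator (D s) x * f (sgn x))" for s x
  have scale: "(LINT x|lborel. indicator (D s) x * f (sgn x)) = s ^ 4 * I" if "s > 0" for s
    using integral_punctured_ball_scale[OF f that] by (simp add: I_def D_def)
  have scale_abs: "(LINT x|lborel. indicator (D s) x * \<bar>f (sgn x)\<bar>) = s ^ 4 * J" if "s > 0" for s
    using integral_punctured_ball_scale[of "\<lambda>x. \<bar>f x\<bar>", OF _ that] by (simp add: J_def D_def)
  have D_empty: "D s = {}" if "s \<le> 0" for s
    using order_trans[OF that norm_ge_zero] by (auto simp: D_def not_less[symmetric])
  \<comment> \<open>Integrability on the product space, required by Fubini, follows because the
    absolute value of \<open>f\<close> on rays obeys the same scaling law.\<close>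
  have norm_h: "(LINT x|lborel. norm (h s x)) = J * norm (v s * s ^ 4)" for s
  proof (cases "s > 0")
    case True
    have "(LINT x|lborel. norm (h s x)) = \<bar>v s\<bar> * (LINT x|lborel. indicator (D s) x * \<bar>f (sgn x)\<bar>)"
      by (simp add: h_def abs_mult)
    with True show ?thesis
      by (simp add: scale_abs abs_mult)
  next
    case False
    then show ?thesis
      by (cases "s = 0") (auto simp: h_def v_def D_empty)
  qed
  have int_h: "integrable (lborel \<Otimes>\<^sub>M lborel) (\<lambda>(s, x). h s x)"
  proof (rule lborel_pair.Fubini_integrable)
    show "(\<lambda>(s, x). h s x) \<in> borel_measurable (lborel \<Otimes>\<^sub>M lborel)"
      unfolding h_def D_def by measurable
    have "integrable lborel (\<lambda>s. v s * s ^ 4)"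
      using radial_density_integrable[of "2 * m" 4] by (simp add: v_def mult.assoc)
    then have "integrable lborel (\<lambda>s. J * norm (v s * s ^ 4))"
      by (intro integrable_mult_right integrable_norm)
    then show "integrable lborel (\<lambda>s. LINT x|lborel. norm (case (s, x) of (s, x) \<Rightarrow> h s x))"
      by (simp only: norm_h prod.case)
    show "AE s in lborel. integrable lborel (\<lambda>x. case (s, x) of (s, x) \<Rightarrow> h s x)"
      using int by (simp add: h_def)
  qed
  have "(LINT x|lborel. f x * exp (- (norm x)\<^sup>2)) = (LINT x|lborel. LINT s|lborel. h s x)"
  proof (rule integral_cong_AE)
    have "(\<lambda>(x, s). h s x) \<in> borel_measurable (lborel \<Otimes>\<^sub>M lborel)"
      unfolding h_def D_def by measurable
    then show "(\<lambda>x. LINT s|lborel. h s x) \<in> borel_measurable lborel"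
      by (rule lborel.borel_measurable_lebesgue_integral)
    \<comment> \<open>No \<open>D s\<close> contains the origin, so \<open>h s 0 = 0\<close>
      whatever \<open>f 0\<close> is; the identity is asserted only away from this null set.\<close>
    show "AE x in lborel. f x * exp (- (norm x)\<^sup>2) = (LINT s|lborel. h s x)"
      using AE_lborel_singleton[of 0]
    proof eventually_elim
      case (elim x)
      then have x: "norm x > 0"
        by simp
      have "h s x = f (sgn x) * (indicator {norm x<..} s * radial_density (2 * m) s)" for s
        using x by (auto simp: h_def v_def D_def indicator_def dest: order.strict_trans1[OF norm_ge_zero])
      then have "(LINT s|lborel. h s x) = f (sgn x) * (norm x ^ (2 * m) * exp (- (norm x)\<^sup>2))"
        by (simp add: radial_density_tail[OF x])
      also have "norm x ^ (2 * m) * f (sgn x) = f x"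
        using hom[of "norm x" "sgn x"] x by (simp add: sgn_div_norm)
      then have "f (sgn x) * (norm x ^ (2 * m) * exp (- (norm x)\<^sup>2)) = f x * exp (- (norm x)\<^sup>2)"
        by (metis mult.assoc mult.commute)
      finally show ?case
        by simp
    qed
  qed measurable
  also have "\<dots> = (LINT s|lborel. LINT x|lborel. h s x)"
    by (rule lborel_pair.Fubini_integral[OF int_h])
  also have "\<dots> = (LINT s|lborel. I * (indicator {0..} s * (radial_density (2 * m) s * s ^ 4)))"
  proof (rule Bochner_Integration.integral_cong[OF refl])
    fix s :: real
    show "(LINT x|lborel. h s x) = I * (indicator {0..} s * (radial_density (2 * m) s * s ^ 4))"
    proof (cases "s > 0")
      case True
      then show ?thesis
        by (simp add: h_def scale v_def)
    next
      case False
      then show ?thesis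
        by (cases "s = 0") (auto simp: h_def v_def D_empty)
    qed
  qed
  also have "\<dots> = I * (2 * fact (m + 1))"
    by (simp only: integral_mult_right_zero radial_density_integral)
  also have "\<dots> = fact (m + 1) / 2 * (4 * I)"
    by simp
  also have "4 * I = (LINT u|sphere_measure. f u)"
    unfolding integral_sphere_measure[OF f] I_def D1 by simp
  finally show "(LINT x|lborel. f x * exp (- (norm x)\<^sup>2)) = fact (m + 1) / 2 * (LINT u|sphere_measure. f u)" .
qed


section \<open>Moments of the sphere and the mixed volumes\<close>

text \<open>Lebesgue measure is the image of a product measure indexed by \<open>Basis\<close>;
  \<open>idx\<close> turns basis vectors back into coordinate indices, after which the product
  integral splits.\<close>

lemma integral_lborel_prod_vec:
  fixes g :: "'n::finite \<Rightarrow> real \<Rightarrow> real"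
  assumes g: "\<And>i. integrable lborel (g i)"
  shows "(LINT x::real^'n|lborel. (\<Prod>i\<in>UNIV. g i (x $ i))) = (\<Prod>i\<in>UNIV. LINT t|lborel. g i t)"
proof -
  let ?P = "\<Pi>\<^sub>M b\<in>(Basis :: (real^'n) set). (lborel :: real measure)"
  interpret product_sigma_finite "\<lambda>b::real^'n. lborel :: real measure"
    by unfold_locales
  define idx where "idx = the_inv (\<lambda>i::'n. axis i (1::real))"
  have inj: "inj (\<lambda>i::'n. axis i (1::real))"
    by (simp add: inj_def axis_eq_axis)
  have idx [simp]: "idx (axis i 1) = i" for i
    unfolding idx_def by (rule the_inv_f_f[OF inj])
  have Basis: "(Basis :: (real^'n) set) = range (\<lambda>i. axis i 1)"
    by (auto simp: Basis_vec_def)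
  have reindex: "(\<Prod>i\<in>UNIV. F i (axis i 1)) = (\<Prod>b\<in>Basis. F (idx b) b)"
    for F :: "'n \<Rightarrow> real^'n \<Rightarrow> real"
    unfolding Basis by (simp add: prod.reindex[OF inj])
  have nth: "(\<Sum>b\<in>Basis. x b *\<^sub>R b) $ i = x (axis i 1)" for x :: "real^'n \<Rightarrow> real" and i
    by (simp only: cart_eq_inner_axis inner_sum_left_Basis axis_in_Basis_iff Basis_real_def) simp
  have lb: "lborel = distr ?P borel (\<lambda>x. \<Sum>b\<in>Basis. x b *\<^sub>R b)"
    by (subst lborel_def) (simp add: lborel_eq_real)
  have [measurable]: "g i \<in> borel_measurable borel" for i
    using borel_measurable_integrable[OF g[of i]] by simp
  have "(LINT x::real^'n|lborel. (\<Prod>i\<in>UNIV. g i (x $ i)))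
      = (LINT x|?P. (\<Prod>i\<in>UNIV. g i ((\<Sum>b\<in>Basis. x b *\<^sub>R b) $ i)))"
    by (subst lb, rule integral_distr) measurable
  also have "\<dots> = (LINT x|?P. (\<Prod>b\<in>Basis. g (idx b) (x b)))"
    unfolding nth by (simp add: reindex[of "\<lambda>i b. g i (_ b)"])
  also have "\<dots> = (\<Prod>b\<in>Basis. LINT t|lborel. g (idx b) t)"
    by (rule product_integral_prod) (auto intro: g)
  also have "\<dots> = (\<Prod>i\<in>UNIV. LINT t|lborel. g i t)"
    by (rule reindex[of "\<lambda>i b. LINT t|lborel. g i t", symmetric])
  finally show ?thesis .
qed

text \<open>The moment of the weight \<open>exp (- x\<^sup>2)\<close> divided by
  \<open>sqrt pi\<close>, which leaves a rational number.\<close>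

definition gauss_moment :: "nat \<Rightarrow> real" where
  "gauss_moment k = (if even k then fact k / (2 ^ k * fact (k div 2)) else 0)"

lemma has_bochner_integral_gauss_moment:
  "has_bochner_integral lborel (\<lambda>x::real. x ^ k * exp (- x\<^sup>2)) (sqrt pi * gauss_moment k)"
proof (cases "even k")
  case True
  then obtain j where k: "k = 2 * j" by blast
  have "has_bochner_integral lborel (\<lambda>x. exp (- x\<^sup>2) * x ^ (2 * j))
      (sqrt pi * (fact (2 * j) / (2 ^ (2 * j) * fact j)))"
    using has_bochner_integral_even_function[OF gaussian_moment_even_pos[where k=j]] by simp
  then show ?thesis
    by (simp add: k gauss_moment_def mult.commute)
next
  case False
  then obtain j where k: "k = 2 * j + 1"
    using oddE by blast
  have "has_bochner_integral lborel (\<lambda>x. exp (- x\<^sup>2) * x ^ (2 * j + 1) :: real) 0"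
    using gaussian_moment_odd_pos by (rule has_bochner_integral_odd_function) simp
  with False show ?thesis
    by (simp add: k gauss_moment_def mult.commute)
qed

definition monomial :: "nat \<times> nat \<times> nat \<times> nat \<Rightarrow> real^4 \<Rightarrow> real" where
  "monomial = (\<lambda>(a, b, c, d) u. (u$1) ^ a * (u$2) ^ b * (u$3) ^ c * (u$4) ^ d)"

lemma prod_4: "prod f (UNIV :: 4 set) = f 1 * f 2 * f 3 * f 4"
  unfolding UNIV_4 by (simp add: ac_simps)

text \<open>Four Gaussian moments contribute four factors \<open>sqrt pi\<close>, that is
  \<open>pi\<^sup>2\<close>; the factor \<open>2 / fact (m + 1)\<close>, for total degree
  \<open>2 * m\<close>, inverts the constant of
  \<open>gaussian_integral_homogeneous\<close>.\<close>

definition sphere_moment :: "nat \<times> nat \<times> nat \<times> nat \<Rightarrow> real" where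
  "sphere_moment = (\<lambda>(a, b, c, d). 2 * pi\<^sup>2 / fact ((a + b + c + d) div 2 + 1) *
     (gauss_moment a * gauss_moment b * gauss_moment c * gauss_moment d))"

lemma has_bochner_integral_sphere_monomial:
  assumes "even (a + b + c + d)"
  shows "has_bochner_integral sphere_measure (monomial (a, b, c, d)) (sphere_moment (a, b, c, d))"
proof -
  obtain m where deg: "a + b + c + d = 2 * m"
    using assms by blast
  let ?f = "monomial (a, b, c, d)"
  define k :: "4 \<Rightarrow> nat" where
    "k i = (if i = 1 then a else if i = 2 then b else if i = 3 then c else d)" for i
  have k: "k 1 = a" "k 2 = b" "k 3 = c" "k 4 = d"
    by (simp_all add: k_def)
  have f_eq: "?f u = (\<Prod>i\<in>UNIV. (u $ i) ^ k i)" for u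
    by (simp add: monomial_def prod_4 k)
  have sum_k: "sum k UNIV = 2 * m"
    using deg by (simp add: sum_4 k)
  have meas [measurable]: "?f \<in> borel_measurable borel"
    unfolding monomial_def prod.case by measurable
  have hom: "?f (t *\<^sub>R u) = t ^ (2 * m) * ?f u" for t u
    by (simp add: f_eq power_mult_distrib prod.distrib power_sum[symmetric] sum_k)
  have bound: "\<bar>?f u\<bar> \<le> 1" if "norm u = 1" for u
  proof -
    have "\<bar>?f u\<bar> = (\<Prod>i\<in>UNIV. \<bar>u $ i\<bar> ^ k i)"
      by (simp add: f_eq abs_prod power_abs)
    also have "\<dots> \<le> 1"
      by (intro prod_le_1 conjI power_le_one) (use component_le_norm_cart[of u] that in auto)
    finally show ?thesis .
  qed
  have "?f x * exp (- (norm x)\<^sup>2) = (\<Prod>i\<in>UNIV. (x $ i) ^ k i * exp (- (x $ i)\<^sup>2))" for x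
  proof -
    have "(norm x)\<^sup>2 = (\<Sum>i\<in>UNIV. (x $ i)\<^sup>2)"
      unfolding power2_norm_eq_inner by (simp add: inner_vec_def power2_eq_square)
    then show ?thesis
      by (simp add: f_eq prod.distrib exp_sum sum_negf[symmetric])
  qed
  then have "(LINT x|lborel. ?f x * exp (- (norm x)\<^sup>2))
      = (\<Prod>i\<in>UNIV. LINT t|lborel. t ^ k i * exp (- t\<^sup>2))"
    using integral_lborel_prod_vec[of "\<lambda>i t. t ^ k i * exp (- t\<^sup>2)"] has_bochner_integral_gauss_moment
    by (auto simp: has_bochner_integral_iff)
  also have "\<dots> = pi\<^sup>2 * (gauss_moment a * gauss_moment b * gauss_moment c * gauss_moment d)"
    using has_bochner_integral_gauss_moment
    by (simp add: has_bochner_integral_iff prod_4 k power2_eq_square)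
  also have "(LINT x|lborel. ?f x * exp (- (norm x)\<^sup>2)) = fact (m + 1) / 2 * (LINT u|sphere_measure. ?f u)"
    by (rule gaussian_integral_homogeneous(2)[OF meas hom bound])
  finally have "(LINT u|sphere_measure. ?f u) = sphere_moment (a, b, c, d)"
    unfolding sphere_moment_def prod.case deg by (simp add: field_simps del: fact_Suc)
  with gaussian_integral_homogeneous(1)[OF meas hom bound] show ?thesis
    by (simp add: has_bochner_integral_iff)
qed

text \<open>Polynomials are lists of coefficients with exponent tuples, so that integrating one is
  evaluating a finite sum of rationals times \<open>pi\<^sup>2\<close>.\<close>

lemma has_bochner_integral_sphere_polynomial:
  assumes "\<forall>(\<alpha>, a, b, c, d)\<in>set ms. even (a + b + c + d)"
  shows "has_bochner_integral sphere_measure (\<lambda>u. \<Sum>(\<alpha>, i)\<leftarrow>ms. \<alpha> * monomial i u)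
    (\<Sum>(\<alpha>, i)\<leftarrow>ms. \<alpha> * sphere_moment i)"
  using assms
proof (induction ms)
  case (Cons x ms)
  obtain \<alpha> a b c d where x: "x = (\<alpha>, a, b, c, d)"
    by (metis prod_cases5)
  have "has_bochner_integral sphere_measure (\<lambda>u. \<alpha> * monomial (a, b, c, d) u)
      (\<alpha> * sphere_moment (a, b, c, d))"
    using Cons.prems by (intro has_bochner_integral_mult_right has_bochner_integral_sphere_monomial) (simp add: x)
  from has_bochner_integral_add[OF this Cons.IH] Cons.prems show ?case
    by (simp add: x)
qed (simp add: has_bochner_integral_zero)

lemma gauss_moment_numeral:
  "gauss_moment 0 = 1" "gauss_moment 2 = 1 / 2" "gauss_moment 4 = 3 / 4" "gauss_moment 6 = 15 / 8"
  "gauss_moment 8 = 105 / 16" "gauss_moment 10 = 945 / 32" "gauss_moment 12 = 10395 / 64"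
  "gauss_moment 1 = 0" "gauss_moment (Suc 0) = 0" "gauss_moment 3 = 0" "gauss_moment 5 = 0"
  "gauss_moment 7 = 0"
  by (simp_all add: gauss_moment_def fact_numeral)

text \<open>Agreement on the unit sphere suffices, and the monomials may have different degrees;
  this admits \<open>q_minus\<close>, which is not homogeneous.\<close>

lemma integral_sphere_polynomial:
  assumes "\<forall>(\<alpha>, a, b, c, d)\<in>set ms. even (a + b + c + d)"
    and "\<And>u. norm u = 1 \<Longrightarrow> f u = (\<Sum>(\<alpha>, i)\<leftarrow>ms. \<alpha> * monomial i u)"
  shows "(LINT u|sphere_measure. f u) = (\<Sum>(\<alpha>, i)\<leftarrow>ms. \<alpha> * sphere_moment i)"
proof -
  have "(LINT u|sphere_measure. f u) = (LINT u|sphere_measure. (\<Sum>(\<alpha>, i)\<leftarrow>ms. \<alpha> * monomial i u))"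
    by (rule Bochner_Integration.integral_cong) (simp_all add: space_sphere_measure assms(2))
  with has_bochner_integral_sphere_polynomial[OF assms(1)] show ?thesis
    by (simp add: has_bochner_integral_iff)
qed

lemma integral_q_minus_squared: "(LINT u|sphere_measure. (q_minus u)\<^sup>2) = pi\<^sup>2 / 32"
  by (subst integral_sphere_polynomial[of "[(1, 6, 0, 0, 0), (- 1, 4, 0, 0, 0), (1/4, 2, 0, 0, 0)]"])
     (simp_all add: q_minus_def monomial_def sphere_moment_def gauss_moment_numeral fact_numeral
       power2_eq_square algebra_simps power_numeral_reduce)

lemma integral_q_plus_squared: "(LINT u|sphere_measure. (q_plus u)\<^sup>2) = pi\<^sup>2 / 12"
  by (subst integral_sphere_polynomial[of "[(1, 4, 0, 2, 0), (-4, 3, 1, 1, 1), (-2, 2, 2, 2, 0),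
        (4, 2, 2, 0, 2), (4, 1, 3, 1, 1), (1, 0, 4, 2, 0)]"])
     (simp_all add: q_plus_def monomial_def sphere_moment_def gauss_moment_numeral fact_numeral
       power2_eq_square algebra_simps power_numeral_reduce)

lemma q_plus_fourth_power:
  "q_plus u ^ 4 = (\<Sum>(\<alpha>, i)\<leftarrow>[(1, 8, 0, 4, 0), (-8, 7, 1, 3, 1), (-4, 6, 2, 4, 0),
     (24, 6, 2, 2, 2), (24, 5, 3, 3, 1), (-32, 5, 3, 1, 3), (6, 4, 4, 4, 0), (-48, 4, 4, 2, 2),
     (16, 4, 4, 0, 4), (-24, 3, 5, 3, 1), (32, 3, 5, 1, 3), (-4, 2, 6, 4, 0), (24, 2, 6, 2, 2),
     (8, 1, 7, 3, 1), (1, 0, 8, 4, 0)]. \<alpha> * monomial i u)"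
  by (simp add: q_plus_def monomial_def) algebra

section \<open>Mixed volumes as integrals of polynomials\<close>

lemma mixed_volume_cubic_diag:
  fixes B :: "real^4 \<Rightarrow> real^4 \<Rightarrow> real^4"
  assumes "symmetric_trilinear B"
    and "\<And>y. norm y = 1 \<Longrightarrow> f y = symmetric_trilinear.cubic B y"
  shows "mixed_volume f f f f = (LINT u|sphere_measure. f u * det (Q_matrix B u)) / 4"
proof -
  have "(LINT u|sphere_measure. f u * mixed_discriminant u (Q_op f u) (Q_op f u) (Q_op f u))
      = (LINT u|sphere_measure. f u * det (Q_matrix B u))"
    by (rule Bochner_Integration.integral_cong)
       (simp_all add: space_sphere_measure mixed_discriminant_Q_op_diag[OF assms])
  then show ?thesis
    by (simp add: mixed_volume_def)
qed

text \<open>The multiple of \<open>B\<close> by \<open>c\<close> is again symmetric trilinear, so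
  the determinant formula applies to it: \<open>f\<close> contributes one factor \<open>c\<close>
  and the three-by-three determinant three more.\<close>

lemma mixed_volume_scaled:
  fixes B :: "real^4 \<Rightarrow> real^4 \<Rightarrow> real^4"
  assumes B: "symmetric_trilinear B"
    and q: "\<And>y. norm y = 1 \<Longrightarrow> q y = symmetric_trilinear.cubic B y"
    and f: "\<And>y. norm y = 1 \<Longrightarrow> f y = c * q y"
  shows "mixed_volume f f f f = c ^ 4 * mixed_volume q q q q"
proof -
  interpret symmetric_trilinear B by fact
  let ?cB = "\<lambda>x y. c *\<^sub>R B x y"
  interpret scaled: symmetric_trilinear ?cB
  proof (rule symmetric_trilinear.intro)
    show "bounded_bilinear ?cB"
      by (rule bounded_bilinear_vec4)
        (simp add: B.add_left scaleR_add_right, simp add: B.scaleR_left mult.commute, metis commute)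
  qed (metis commute, simp add: selfadjoint)
  have "f y = scaled.cubic y" if "norm y = 1" for y
    using f[OF that] q[OF that] by (simp add: scaled.cubic_def cubic_def)
  then have "mixed_volume f f f f = (LINT u|sphere_measure. f u * det (Q_matrix ?cB u)) / 4"
    by (rule mixed_volume_cubic_diag[OF scaled.symmetric_trilinear_axioms])
  also have "(LINT u|sphere_measure. f u * det (Q_matrix ?cB u))
      = (LINT u|sphere_measure. c ^ 4 * (q u * det (Q_matrix B u)))"
  proof (rule Bochner_Integration.integral_cong[OF refl])
    fix u :: "real^4" assume "u \<in> space sphere_measure"
    then have "f u = c * q u"
      by (simp add: space_sphere_measure f)
    then show "f u * det (Q_matrix ?cB u) = c ^ 4 * (q u * det (Q_matrix B u))"
      by (simp add: det_3 Q_matrix_scale algebra_simps power4_eq_xxxx)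
  qed
  finally show ?thesis
    by (simp add: mixed_volume_cubic_diag[OF B q])
qed

text \<open>A third of the trace is \<open>- 4 * f u\<close>, and the 4 cancels the normalization
  \<open>1/4\<close> of the mixed volume.\<close>

lemma mixed_volume_cubic_one:
  fixes B :: "real^4 \<Rightarrow> real^4 \<Rightarrow> real^4"
  assumes "symmetric_trilinear B"
    and "\<And>y. norm y = 1 \<Longrightarrow> f y = symmetric_trilinear.cubic B y"
    and tr: "\<And>u. norm u = 1 \<Longrightarrow> trace (Q_matrix B u) = - 12 * f u"
  shows "- mixed_volume f f (\<lambda>_. 1) (\<lambda>_. 1) = (sphere_L2_norm f)\<^sup>2"
proof -
  have "(LINT u|sphere_measure. f u * mixed_discriminant u (Q_op f u) (Q_op (\<lambda>_. 1) u) (Q_op (\<lambda>_. 1) u))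
      = (LINT u|sphere_measure. - 4 * (f u)\<^sup>2)"
    by (rule Bochner_Integration.integral_cong)
       (simp_all add: space_sphere_measure mixed_discriminant_Q_op_one[OF assms(1,2)] tr power2_eq_square)
  also have "\<dots> = - 4 * (LINT u|sphere_measure. (f u)\<^sup>2)"
    by (rule integral_mult_right_zero)
  finally show ?thesis
    by (simp add: mixed_volume_def sphere_L2_norm_def)
qed

lemma integral_q_plus_fourth_power: "(LINT u|sphere_measure. q_plus u ^ 4) = pi\<^sup>2 / 140"
  by (subst integral_sphere_polynomial[OF _ q_plus_fourth_power])
     (simp_all add: sphere_moment_def gauss_moment_numeral fact_numeral)

text \<open>By \<open>det_Q_matrix_plus\<close>, the integrand of the mixed volume of
  \<open>q_plus\<close> combines this polynomial with the fourth power of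
  \<open>q_plus\<close>.\<close>

lemma q_plus_weighted:
  "((u$1)\<^sup>2 + (u$2)\<^sup>2)\<^sup>2 * (q_plus u)\<^sup>2 = (\<Sum>(\<alpha>, i)\<leftarrow>[(1, 8, 0, 2, 0), (-4, 7, 1, 1, 1),
     (4, 6, 2, 0, 2), (-4, 5, 3, 1, 1), (-2, 4, 4, 2, 0), (8, 4, 4, 0, 2), (4, 3, 5, 1, 1),
     (4, 2, 6, 0, 2), (4, 1, 7, 1, 1), (1, 0, 8, 2, 0)]. \<alpha> * monomial i u)"
  by (simp add: q_plus_def monomial_def) algebra

lemma integral_q_plus_weighted: "(LINT u|sphere_measure. ((u$1)\<^sup>2 + (u$2)\<^sup>2)\<^sup>2 * (q_plus u)\<^sup>2) = pi\<^sup>2 / 30"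
  by (subst integral_sphere_polynomial[OF _ q_plus_weighted])
     (simp_all add: sphere_moment_def gauss_moment_numeral fact_numeral)

lemma sphere_L2_norm_q_minus: "(sphere_L2_norm q_minus)\<^sup>2 = pi\<^sup>2 / 32"
  by (simp add: sphere_L2_norm_def integral_q_minus_squared)

lemma sphere_L2_norm_q_plus: "(sphere_L2_norm q_plus)\<^sup>2 = pi\<^sup>2 / 12"
  by (simp add: sphere_L2_norm_def integral_q_plus_squared)

lemma mixed_volume_q_minus_one:
  "- mixed_volume q_minus q_minus (\<lambda>_. 1) (\<lambda>_. 1) = (sphere_L2_norm q_minus)\<^sup>2"
  by (rule mixed_volume_cubic_one[OF minus.symmetric_trilinear_axioms q_minus_eq_cubic trace_Q_matrix_minus])

lemma mixed_volume_q_plus_one: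
  "- mixed_volume q_plus q_plus (\<lambda>_. 1) (\<lambda>_. 1) = (sphere_L2_norm q_plus)\<^sup>2"
  by (rule mixed_volume_cubic_one[OF plus.symmetric_trilinear_axioms q_plus_eq_cubic trace_Q_matrix_plus])

lemma mixed_volume_q_minus: "mixed_volume q_minus q_minus q_minus q_minus = - (3 * pi\<^sup>2 / 128)"
proof -
  \<comment> \<open>The list expands \<open>q_minus u * (24 * (u$1) ^ 7 - 32 * (u$1) ^ 9)\<close>, a
    polynomial in \<open>u$1\<close> alone.\<close>
  have "(LINT u|sphere_measure. q_minus u * det (Q_matrix B_minus u)) = - (3 * pi\<^sup>2 / 32)"
    by (subst integral_sphere_polynomial[of "[(- 32, 12, 0, 0, 0), (40, 10, 0, 0, 0), (- 12, 8, 0, 0, 0)]"])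
       (simp_all add: det_Q_matrix_minus q_minus_def monomial_def sphere_moment_def gauss_moment_numeral
         fact_numeral algebra_simps power_numeral_reduce)
  then show ?thesis
    by (simp add: mixed_volume_cubic_diag[OF minus.symmetric_trilinear_axioms q_minus_eq_cubic])
qed

lemma mixed_volume_q_plus: "mixed_volume q_plus q_plus q_plus q_plus = pi\<^sup>2 / 7"
proof -
  have int: "integrable sphere_measure (\<lambda>u. ((u$1)\<^sup>2 + (u$2)\<^sup>2)\<^sup>2 * (q_plus u)\<^sup>2)"
    "integrable sphere_measure (\<lambda>u. q_plus u ^ 4)"
    unfolding q_plus_weighted q_plus_fourth_power
    by (rule has_bochner_integral_sphere_polynomial[THEN has_bochner_integral_iff[THEN iffD1], THEN conjunct1]; simp)+
  have "(LINT u|sphere_measure. q_plus u * det (Q_matrix B_plus u))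
      = (LINT u|sphere_measure. 24 * (((u$1)\<^sup>2 + (u$2)\<^sup>2)\<^sup>2 * (q_plus u)\<^sup>2) - 32 * q_plus u ^ 4)"
    by (rule Bochner_Integration.integral_cong)
       (simp_all add: space_sphere_measure det_Q_matrix_plus algebra_simps power_numeral_reduce)
  also have "\<dots> = 24 * (pi\<^sup>2 / 30) - 32 * (pi\<^sup>2 / 140)"
    using int by (simp add: integral_q_plus_weighted integral_q_plus_fourth_power)
  finally show ?thesis
    by (simp add: mixed_volume_cubic_diag[OF plus.symmetric_trilinear_axioms q_plus_eq_cubic])
qed


section \<open>Smooth functions and inverse maps\<close>

lemma Cn_on_cong:
  assumes "open U" "\<And>x. x \<in> U \<Longrightarrow> f x = g x" "Cn_on n f U"
  shows "Cn_on n g U"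
  using assms(2,3)
proof (induction n arbitrary: f g)
  case 0
  then show ?case
    using continuous_on_cong by (metis Cn_on.simps(1))
next
  case (Suc n)
  have eq: "frechet_derivative f (at x) = frechet_derivative g (at x)" if "x \<in> U" for x
    using Suc.prems that by (intro frechet_derivative_transform_within_open[OF _ assms(1)]) auto
  have "g differentiable at x" if x: "x \<in> U" for x
  proof -
    have "f differentiable at x"
      using Suc.prems(2) x by (simp only: Cn_on.simps)
    then obtain f' where "(f has_derivative f') (at x)"
      unfolding differentiable_def by blast
    then have "(g has_derivative f') (at x)"
      by (rule has_derivative_transform_within_open[OF _ assms(1) x]) (rule Suc.prems(1))
    then show ?thesis
      unfolding differentiable_def by blast
  qed
  moreover have "Cn_on n (\<lambda>x. frechet_derivative g (at x) v) U" for v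
  proof (rule Suc.IH)
    show "frechet_derivative f (at x) v = frechet_derivative g (at x) v" if "x \<in> U" for x
      by (simp only: eq[OF that])
    show "Cn_on n (\<lambda>x. frechet_derivative f (at x) v) U"
      using Suc.prems(2) by (simp only: Cn_on.simps)
  qed
  ultimately show ?case
    by simp
qed

lemma Cn_on_SucI:
  assumes "open U" "\<And>x. x \<in> U \<Longrightarrow> (f has_derivative f' x) (at x)" "\<And>v. Cn_on n (\<lambda>x. f' x v) U"
  shows "Cn_on (Suc n) f U"
proof -
  have "Cn_on n (\<lambda>x. frechet_derivative f (at x) v) U" for v
    by (rule Cn_on_cong[OF assms(1) _ assms(3)[of v]]) (metis assms(2) frechet_derivative_at)
  with assms(2) show ?thesis
    by (auto simp: differentiable_def)
qed

lemma Cn_on_SucD: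
  assumes "Cn_on (Suc n) f U" "x \<in> U"
  shows "(f has_derivative frechet_derivative f (at x)) (at x)"
  using assms by (simp add: frechet_derivative_works)

lemma Cn_on_lower: "Cn_on (Suc n) f U \<Longrightarrow> Cn_on n f U"
proof (induction n arbitrary: f)
  case 0
  then show ?case
    by (auto intro!: continuous_at_imp_continuous_on differentiable_imp_continuous_within)
qed simp

lemma Cn_on_const: "open U \<Longrightarrow> Cn_on n (\<lambda>_. c) U"
proof (induction n arbitrary: c)
  case (Suc n)
  then show ?case
    by (intro Cn_on_SucI[where f' = "\<lambda>_ _. 0"]) auto
qed simp

lemma Cn_on_inner: "open U \<Longrightarrow> Cn_on n (\<lambda>x. x \<bullet> b) U"
proof (cases n)
  case (Suc m)
  assume "open U"
  then show ?thesis
    unfolding Suc by (intro Cn_on_SucI[where f' = "\<lambda>_ v. v \<bullet> b"]) (auto intro!: derivative_eq_intros Cn_on_const)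
qed (auto intro: continuous_intros)

lemma Cn_on_add:
  assumes "open U" "Cn_on n f U" "Cn_on n g U"
  shows "Cn_on n (\<lambda>x. f x + g x) U"
  using assms(2,3)
proof (induction n arbitrary: f g)
  case (Suc n)
  show ?case
  proof (rule Cn_on_SucI[OF assms(1)])
    show "((\<lambda>x. f x + g x) has_derivative
        (\<lambda>v. frechet_derivative f (at x) v + frechet_derivative g (at x) v)) (at x)" if "x \<in> U" for x
      using Suc.prems[THEN Cn_on_SucD, OF that] by (auto intro!: derivative_eq_intros)
    show "Cn_on n (\<lambda>x. frechet_derivative f (at x) v + frechet_derivative g (at x) v) U" for v
      using Suc.prems by (intro Suc.IH) auto
  qed
qed (auto intro: continuous_intros)

lemma Cn_on_mult:
  assumes "open U" "Cn_on n f U" "Cn_on n g U"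
  shows "Cn_on n (\<lambda>x. f x * g x) U"
  using assms(2,3)
proof (induction n arbitrary: f g)
  case (Suc n)
  show ?case
  proof (rule Cn_on_SucI[OF assms(1)])
    show "((\<lambda>x. f x * g x) has_derivative
        (\<lambda>v. f x * frechet_derivative g (at x) v + frechet_derivative f (at x) v * g x)) (at x)" if "x \<in> U" for x
      using Suc.prems[THEN Cn_on_SucD, OF that] by (auto intro!: derivative_eq_intros)
    show "Cn_on n (\<lambda>x. f x * frechet_derivative g (at x) v + frechet_derivative f (at x) v * g x) U" for v
      using Suc.prems Suc.prems[THEN Cn_on_lower] by (intro Cn_on_add[OF assms(1)] Suc.IH) auto
  qed
qed (auto intro: continuous_intros)

lemma Cn_on_sum:
  assumes "open U" "\<And>i. i \<in> A \<Longrightarrow> Cn_on n (f i) U"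
  shows "Cn_on n (\<lambda>x. \<Sum>i\<in>A. f i x) U"
  using assms(2)
proof (induction A rule: infinite_finite_induct)
  case (insert a A)
  then have "Cn_on n (\<lambda>x. f a x + (\<Sum>i\<in>A. f i x)) U"
    by (intro Cn_on_add[OF assms(1)]) auto
  then show ?case using insert.hyps by simp
qed (simp_all add: Cn_on_const[OF assms(1)])

lemma Cn_on_prod:
  assumes "open U" "\<And>i. i \<in> A \<Longrightarrow> Cn_on n (f i) U"
  shows "Cn_on n (\<lambda>x. \<Prod>i\<in>A. f i x) U"
  using assms(2)
proof (induction A rule: infinite_finite_induct)
  case (insert a A)
  then have "Cn_on n (\<lambda>x. f a x * (\<Prod>i\<in>A. f i x)) U"
    by (intro Cn_on_mult[OF assms(1)]) auto
  then show ?case using insert.hyps by simp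
qed (simp_all add: Cn_on_const[OF assms(1)])

text \<open>The derivative of the reciprocal contains the reciprocal again, so each order rests on
  the previous one for the same \<open>f\<close>.\<close>

lemma Cn_on_inverse:
  assumes "open U" "Cn_on n f U" and nz: "\<And>x. x \<in> U \<Longrightarrow> f x \<noteq> 0"
  shows "Cn_on n (\<lambda>x. inverse (f x)) U"
  using assms(2)
proof (induction n)
  case 0
  then show ?case using nz by (auto intro: continuous_intros)
next
  case (Suc n)
  have IH: "Cn_on n (\<lambda>x. inverse (f x)) U"
    using Suc.IH Suc.prems Cn_on_lower by blast
  show ?case
  proof (rule Cn_on_SucI[OF assms(1)])
    show "((\<lambda>x. inverse (f x)) has_derivative
        (\<lambda>v. - 1 * (inverse (f x) * frechet_derivative f (at x) v * inverse (f x)))) (at x)" if "x \<in> U" for x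
      using Cn_on_SucD[OF Suc.prems that] nz[OF that] by (auto intro!: derivative_eq_intros)
    show "Cn_on n (\<lambda>x. - 1 * (inverse (f x) * frechet_derivative f (at x) v * inverse (f x))) U" for v
      using IH Suc.prems by (intro Cn_on_mult[OF assms(1)] Cn_on_const[OF assms(1)]) auto
  qed
qed

text \<open>The chain rule in coordinates gives sums of products of components of \<open>G'\<close>
  with partial derivatives of \<open>f\<close> composed with \<open>G\<close>; these compositions
  are why the induction runs over all \<open>f\<close>.\<close>

lemma Cn_on_compose:
  fixes f :: "'b::euclidean_space \<Rightarrow> real" and G :: "'a::euclidean_space \<Rightarrow> 'b"
  assumes V: "open V" and sub: "G ` V \<subseteq> U"
    and "Cn_on n f U" and "\<And>b. b \<in> Basis \<Longrightarrow> Cn_on n (\<lambda>z. G z \<bullet> b) V"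
  shows "Cn_on n (\<lambda>z. f (G z)) V"
  using assms(3,4)
proof (induction n arbitrary: f)
  case 0
  then have "continuous_on V G"
    by (auto simp: continuous_on_componentwise[of V G])
  with 0 sub show ?case
    by (auto intro: continuous_on_compose2)
next
  case (Suc n)
  let ?G' = "\<lambda>z v. \<Sum>b\<in>Basis. frechet_derivative (\<lambda>z. G z \<bullet> b) (at z) v *\<^sub>R b"
  have G: "(G has_derivative ?G' z) (at z)" if "z \<in> V" for z
    unfolding has_derivative_componentwise_within[of G]
    using Suc.prems(2)[THEN Cn_on_SucD, OF _ that] by (auto simp: inner_sum_left_Basis)
  show ?case
  proof (rule Cn_on_SucI[OF V])
    fix z assume z: "z \<in> V"
    have f: "(f has_derivative frechet_derivative f (at (G z))) (at (G z))"
      using Suc.prems(1) z sub by (intro Cn_on_SucD) auto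
    have "((\<lambda>z. f (G z)) has_derivative (\<lambda>v. frechet_derivative f (at (G z)) (?G' z v))) (at z)"
      by (rule has_derivative_compose[OF G[OF z] f])
    moreover have "frechet_derivative f (at (G z)) (?G' z v) =
        (\<Sum>b\<in>Basis. frechet_derivative (\<lambda>z. G z \<bullet> b) (at z) v * frechet_derivative f (at (G z)) b)" for v
      using has_derivative_linear[OF f] by (simp add: linear_sum linear_scale)
    ultimately show "((\<lambda>z. f (G z)) has_derivative (\<lambda>v. \<Sum>b\<in>Basis. frechet_derivative (\<lambda>z. G z \<bullet> b) (at z) v
        * frechet_derivative f (at (G z)) b)) (at z)"
      by simp
  next
    fix v
    have "Cn_on n (\<lambda>z. frechet_derivative f (at (G z)) b) V" for b
      using Suc.prems by (intro Suc.IH[of "\<lambda>y. frechet_derivative f (at y) b"]) (auto intro: Cn_on_lower simp del: Cn_on.simps(2) simp: Cn_on.simps(2)[of _ f])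
    then show "Cn_on n (\<lambda>z. \<Sum>b\<in>Basis. frechet_derivative (\<lambda>z. G z \<bullet> b) (at z) v
        * frechet_derivative f (at (G z)) b) V"
      using Suc.prems(2) by (intro Cn_on_sum[OF V] Cn_on_mult[OF V]) auto
  qed
qed

lemma Cn_on_det:
  fixes A :: "'a::euclidean_space \<Rightarrow> real^'n^'n"
  assumes "open U" "\<And>i j. Cn_on n (\<lambda>x. A x $ i $ j) U"
  shows "Cn_on n (\<lambda>x. det (A x)) U"
  unfolding det_def using assms
  by (intro Cn_on_sum Cn_on_mult Cn_on_prod Cn_on_const) auto

text \<open>The derivative of \<open>G\<close> is the inverse of that of \<open>f\<close> at
  \<open>G z\<close>. By Cramer's rule its entries are quotients of determinants in the derivatives
  of \<open>f\<close> at \<open>G z\<close>, which are as smooth as \<open>G\<close> is already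
  known to be, so each step gains one order.\<close>

lemma Cn_on_inverse_map:
  fixes f G :: "real^'n \<Rightarrow> real^'n"
  assumes V: "open V" and sub: "G ` V \<subseteq> U"
    and f: "\<And>n i. Cn_on n (\<lambda>x. f x $ i) U"
    and f': "\<And>x. x \<in> U \<Longrightarrow> (f has_derivative f' x) (at x)"
    and G': "\<And>z. z \<in> V \<Longrightarrow> (G has_derivative G' z) (at z)"
    and inv: "\<And>z v. z \<in> V \<Longrightarrow> f' (G z) (G' z v) = v"
  shows "Cn_on n (\<lambda>z. G z $ i) V"
proof (induction n arbitrary: i)
  case 0
  have "continuous_on V G"
    using G' has_derivative_continuous continuous_at_imp_continuous_on by blast
  then show ?case
    by (auto intro: continuous_intros)
next
  case (Suc n)
  define A where "A z = matrix (f' (G z))" for z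
  have lin: "linear (f' (G z))" if "z \<in> V" for z
    using f' sub that by (intro has_derivative_linear) auto
  have Av: "A z *v G' z v = v" if "z \<in> V" for z v
    using inv that lin by (simp add: A_def matrix_works)
  have detA: "det (A z) \<noteq> 0" if "z \<in> V" for z
  proof -
    have "A z ** matrix (G' z) = mat 1"
      unfolding matrix_eq matrix_vector_mul_assoc[symmetric]
      using Av that G'[OF that] by (simp add: matrix_works has_derivative_linear)
    from arg_cong[OF this, of det] show ?thesis
      by (auto simp: det_mul)
  qed
  have G'_eq: "G' z v $ i = det (\<chi> k l. if l = i then v $ k else A z $ k $ l) * inverse (det (A z))"
    if "z \<in> V" for z v
    using cramer[OF detA[OF that], of "G' z v" v] Av[OF that] by (simp add: divide_inverse)
  have A: "Cn_on n (\<lambda>z. A z $ k $ l) V" for k l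
  proof (rule Cn_on_cong[OF V])
    show "Cn_on n (\<lambda>z. frechet_derivative (\<lambda>x. f x $ k) (at (G z)) (axis l 1)) V"
      using f[of "Suc n" k] Suc
      by (intro Cn_on_compose[OF V sub, of n "\<lambda>x. frechet_derivative (\<lambda>x. f x $ k) (at x) (axis l 1)"])
         (auto simp: Basis_vec_def inner_axis)
    fix z assume z: "z \<in> V"
    then have "((\<lambda>x. f x $ k) has_derivative (\<lambda>v. f' (G z) v $ k)) (at (G z))"
      using f' sub by (auto intro!: derivative_eq_intros bounded_linear.has_derivative[OF bounded_linear_vec_nth])
    then show "frechet_derivative (\<lambda>x. f x $ k) (at (G z)) (axis l 1) = A z $ k $ l"
      by (simp add: A_def matrix_def frechet_derivative_at[symmetric])
  qed
  show ?case
  proof (rule Cn_on_SucI[OF V])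
    show "((\<lambda>z. G z $ i) has_derivative (\<lambda>v. G' z v $ i)) (at z)" if "z \<in> V" for z
      by (rule bounded_linear.has_derivative[OF bounded_linear_vec_nth G'[OF that]])
    show "Cn_on n (\<lambda>z. G' z v $ i) V" for v
    proof (rule Cn_on_cong[OF V])
      have "Cn_on n (\<lambda>z. if l = i then v $ k else A z $ k $ l) V" for k l
        by (cases "l = i") (simp_all add: A Cn_on_const[OF V])
      then       show "Cn_on n (\<lambda>z. det (\<chi> k l. if l = i then v $ k else A z $ k $ l) * inverse (det (A z))) V"
        using A detA
        by (intro Cn_on_mult[OF V] Cn_on_inverse[OF V] Cn_on_det[OF V]) auto
    qed (simp add: G'_eq)
  qed
qed


section \<open>The dual map of a cubic form\<close>

text \<open>On the segment from the identity to \<open>M\<close> the quadratic form stays positive,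
  so no matrix on it is singular and the determinant keeps its sign. This covers nonsymmetric
  \<open>M\<close> as well.\<close>

lemma det_pos_if_positive_definite:
  fixes M :: "real^'n^'n"
  assumes pos: "\<And>x. x \<noteq> 0 \<Longrightarrow> x \<bullet> (M *v x) > 0"
  shows "det M > 0"
proof (rule ccontr)
  assume neg: "\<not> det M > 0"
  define A :: "real \<Rightarrow> real^'n^'n" where "A t = (1 - t) *\<^sub>R mat 1 + t *\<^sub>R M" for t
  have "continuous_on {0..1} (\<lambda>t. det (A t))"
    unfolding det_def A_def by (intro continuous_intros)
  moreover have "det (A 1) \<le> 0" "0 \<le> det (A 0)"
    using neg by (simp_all add: A_def)
  ultimately obtain t where t: "0 \<le> t" "t \<le> 1" "det (A t) = 0"
    using IVT2'[of "\<lambda>t. det (A t)" 1 0 0] by auto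
  then obtain x where x: "x \<noteq> 0" "A t *v x = 0"
    by (metis invertible_det_nz invertible_left_inverse matrix_left_invertible_ker)
  have "x \<bullet> (A t *v x) = (1 - t) * (x \<bullet> x) + t * (x \<bullet> (M *v x))"
    by (simp add: A_def matrix_vector_mult_add_rdistrib scaleR_matrix_vector_assoc[symmetric] inner_simps)
  also have "\<dots> > 0"
  proof (cases "t = 0")
    case False
    with t pos[OF x(1)] have "t * (x \<bullet> (M *v x)) > 0" by simp
    then show ?thesis
      using t by (simp add: add_nonneg_pos)
  qed (use x in simp)
  finally show False
    using x by simp
qed

lemma linear_inverse_of_expansion:
  fixes f :: "'a::euclidean_space \<Rightarrow> 'a"
  assumes "linear f" and c: "c > 0" "\<And>v. norm (f v) \<ge> c * norm v"
  shows "linear (inv f)" "f (inv f v) = v" "inv f (f v) = v"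
proof -
  have "inj f"
    using c by (metis assms(1) linear_injective_0 mult_pos_pos norm_zero not_le zero_less_norm_iff)
  moreover from this have "surj f"
    using assms(1) linear_injective_imp_surjective by blast
  ultimately have "bij f" by (simp add: bij_def)
  then show "f (inv f v) = v" "inv f (f v) = v"
    by (simp_all add: bij_is_surj bij_is_inj surj_f_inv_f)
  then show "linear (inv f)"
    using \<open>inj f\<close> \<open>surj f\<close> assms(1)
    by (metis inv_unique_comp linear_injective_isomorphism o_def fun_eq_iff id_apply)
qed

context symmetric_trilinear
begin

text \<open>The gradient of \<open>cubic x / (x \<bullet> x)\<close>, homogeneous of degree 0.\<close>

definition dual :: "'a \<Rightarrow> 'a" where
  "dual x = (1 / (x \<bullet> x)) *\<^sub>R grad x - (2 * cubic x / (x \<bullet> x)\<^sup>2) *\<^sub>R x"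

text \<open>The Hessian of \<open>cubic x / (x \<bullet> x)\<close>. This is why it is self-adjoint
  and, since \<open>dual\<close> has degree 0, why it annihilates \<open>x\<close>.\<close>

definition dual_deriv :: "'a \<Rightarrow> 'a \<Rightarrow> 'a" where
  "dual_deriv x v = (1 / (x \<bullet> x)) *\<^sub>R B x v - (2 * (x \<bullet> v) / (x \<bullet> x)\<^sup>2) *\<^sub>R grad x
     - (2 * (grad x \<bullet> v) / (x \<bullet> x)\<^sup>2) *\<^sub>R x - (2 * cubic x / (x \<bullet> x)\<^sup>2) *\<^sub>R v
     + (8 * cubic x * (x \<bullet> v) / (x \<bullet> x) ^ 3) *\<^sub>R x"

lemma grad_scale: "grad (t *\<^sub>R x) = t\<^sup>2 *\<^sub>R grad x"
  by (simp add: grad_def B.scaleR_left B.scaleR_right power2_eq_square)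

lemma dual_scale:
  assumes "t > 0"
  shows "dual (t *\<^sub>R x) = dual x"
  using assms by (simp add: dual_def grad_scale cubic_scale power2_eq_square power3_eq_cube)

lemma dual_unit: "norm u = 1 \<Longrightarrow> dual u = grad u - (2 * cubic u) *\<^sub>R u"
  by (simp add: dual_def norm_eq_1)

lemma dual_inner_self: "norm u = 1 \<Longrightarrow> dual u \<bullet> u = cubic u"
  by (simp add: dual_unit inner_simps inner_grad_self norm_eq_1)

lemma dual_has_derivative:
  assumes "x \<noteq> 0"
  shows "(dual has_derivative dual_deriv x) (at x)"
proof -
  define i where "i y = inverse (y \<bullet> y)" for y :: 'a
  have i: "(i has_derivative (\<lambda>v. - (i x * (2 * (x \<bullet> v)) * i x))) (at x)"
    unfolding i_def using assms by (auto intro!: derivative_eq_intros simp: inner_commute)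
  have "((\<lambda>x. i x *\<^sub>R grad x - (2 * cubic x * (i x)\<^sup>2) *\<^sub>R x) has_derivative
      (\<lambda>v. i x *\<^sub>R B x v + (- (i x * (2 * (x \<bullet> v)) * i x)) *\<^sub>R grad x
        - ((2 * cubic x * (i x)\<^sup>2) *\<^sub>R v
           + (2 * (grad x \<bullet> v) * (i x)\<^sup>2 + 2 * cubic x * (2 * i x * (- (i x * (2 * (x \<bullet> v)) * i x)))) *\<^sub>R x))) (at x)"
    by (auto intro!: derivative_eq_intros i simp: algebra_simps)
  moreover have "i x *\<^sub>R B x v + (- (i x * (2 * (x \<bullet> v)) * i x)) *\<^sub>R grad x
        - ((2 * cubic x * (i x)\<^sup>2) *\<^sub>R v
           + (2 * (grad x \<bullet> v) * (i x)\<^sup>2 + 2 * cubic x * (2 * i x * (- (i x * (2 * (x \<bullet> v)) * i x)))) *\<^sub>R x)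
      = dual_deriv x v" for v
    by (simp add: dual_deriv_def i_def divide_inverse power2_eq_square power3_eq_cube algebra_simps)
  moreover have "dual = (\<lambda>x. i x *\<^sub>R grad x - (2 * cubic x * (i x)\<^sup>2) *\<^sub>R x)"
    by (simp add: fun_eq_iff dual_def i_def divide_inverse power_inverse)
  ultimately show ?thesis
    by simp
qed

lemma dual_deriv_self:
  assumes "x \<noteq> 0"
  shows "dual_deriv x x = 0"
proof -
  have "(cubic x * 8 / (x \<bullet> x)\<^sup>2) *\<^sub>R x
      = (2 * cubic x / (x \<bullet> x)\<^sup>2) *\<^sub>R x + (cubic x * 6 / (x \<bullet> x)\<^sup>2) *\<^sub>R x"
    by (simp flip: scaleR_left_distrib add_divide_distrib)
  then show ?thesis
    using assms by (simp add: dual_deriv_def B_self inner_grad_self power2_eq_square power3_eq_cube algebra_simps)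
qed

lemma dual_deriv_selfadjoint: "dual_deriv x v \<bullet> w = v \<bullet> dual_deriv x w"
proof -
  have "w \<bullet> B x v = v \<bullet> B x w"
    by (metis selfadjoint inner_commute)
  then show ?thesis
    by (simp add: dual_deriv_def inner_simps inner_commute algebra_simps)
qed

lemma linear_dual_deriv: "linear (dual_deriv x)"
  by (rule linearI) (simp_all add: dual_deriv_def B.add_right B.scaleR_right inner_simps
      add_divide_distrib algebra_simps)

end

locale bounded_symmetric_trilinear = symmetric_trilinear +
  fixes C :: real
  assumes C_pos: "C > 0" and norm_B: "norm (B x y) \<le> C * norm x * norm y"
begin

lemma abs_B_inner: "\<bar>B x y \<bullet> z\<bar> \<le> C * norm x * norm y * norm z"
  using Cauchy_Schwarz_ineq2[of "B x y" z] norm_B[of x y]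
  by (meson mult_right_mono norm_ge_zero order_trans)

lemma abs_cubic: "\<bar>cubic x\<bar> \<le> C * norm x ^ 3 / 6"
  using abs_B_inner[of x x x] by (simp add: cubic_def power3_eq_cube mult.assoc)

lemma norm_grad: "norm (grad x) \<le> C * (norm x)\<^sup>2 / 2"
  using norm_B[of x x] by (simp add: grad_def power2_eq_square)

text \<open>The five summands are at most 1, 1, 1, 1/3 and 4/3 times
  \<open>C * norm v / norm x\<close>; the total 14/3 is rounded up to 5.\<close>

lemma norm_dual_deriv:
  assumes "x \<noteq> 0"
  shows "norm (dual_deriv x v) \<le> 5 * C * norm v / norm x"
proof -
  define n where "n = norm x"
  have n: "n > 0" using assms by (simp add: n_def)
  have N: "x \<bullet> x = n\<^sup>2"
    by (simp add: n_def power2_norm_eq_inner)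
  have xv: "\<bar>x \<bullet> v\<bar> \<le> n * norm v" and gv: "\<bar>grad x \<bullet> v\<bar> \<le> (C * n\<^sup>2 / 2) * norm v"
    using Cauchy_Schwarz_ineq2[of x v] Cauchy_Schwarz_ineq2[of "grad x" v]
      mult_right_mono[OF norm_grad[of x] norm_ge_zero[of v]]
    by (auto simp: n_def)
  have c: "\<bar>cubic x\<bar> \<le> C * n ^ 3 / 6"
    using abs_cubic[of x] by (simp add: n_def)
  have 1: "norm ((1 / (x \<bullet> x)) *\<^sub>R B x v) \<le> C * norm v / n"
    using norm_B[of x v] n by (simp add: N n_def[symmetric] field_simps power2_eq_square)
  have 2: "norm ((2 * (x \<bullet> v) / (x \<bullet> x)\<^sup>2) *\<^sub>R grad x) \<le> C * norm v / n"
  proof -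
    have "\<bar>x \<bullet> v\<bar> * norm (grad x) \<le> (n * norm v) * (C * n\<^sup>2 / 2)"
      using xv norm_grad[of x] n by (intro mult_mono) (auto simp: n_def)
    then show ?thesis
      using n by (simp add: N abs_mult field_simps power2_eq_square)
  qed
  have 3: "norm ((2 * (grad x \<bullet> v) / (x \<bullet> x)\<^sup>2) *\<^sub>R x) \<le> C * norm v / n"
    using gv n by (simp add: N n_def[symmetric] abs_mult field_simps power2_eq_square)
  have 4: "norm ((2 * cubic x / (x \<bullet> x)\<^sup>2) *\<^sub>R v) \<le> (C * norm v / n) / 3"
  proof -
    have "\<bar>cubic x\<bar> * norm v \<le> (C * n ^ 3 / 6) * norm v"
      using c by (intro mult_right_mono) auto
    then show ?thesis
      using n by (simp add: N abs_mult field_simps power2_eq_square power3_eq_cube)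
  qed
  have 5: "norm ((8 * cubic x * (x \<bullet> v) / (x \<bullet> x) ^ 3) *\<^sub>R x) \<le> 4 * (C * norm v / n) / 3"
  proof -
    have "\<bar>cubic x\<bar> * \<bar>x \<bullet> v\<bar> \<le> (C * n ^ 3 / 6) * (n * norm v)"
      using c xv by (intro mult_mono) auto
    then show ?thesis
      using n by (simp add: N n_def[symmetric] abs_mult field_simps power2_eq_square power3_eq_cube)
  qed
  have "norm (dual_deriv x v) \<le> C * norm v / n + C * norm v / n + C * norm v / n + (C * norm v / n) / 3
      + 4 * (C * norm v / n) / 3"
    unfolding dual_deriv_def
    by (intro order_trans[OF norm_triangle_ineq] order_trans[OF norm_triangle_ineq4] add_mono 1 2 3 4 5)
  also have "\<dots> \<le> 5 * (C * norm v / n)"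
  proof -
    have "C * norm v / n \<ge> 0"
      using C_pos n by simp
    moreover have "k + k + k + k / 3 + 4 * k / 3 \<le> 5 * k" if "k \<ge> 0" for k :: real
      using that by simp
    ultimately show ?thesis
      by blast
  qed
  finally show ?thesis
    by (simp add: n_def)
qed

text \<open>\<open>dual u \<bullet> v\<close> is the linearization at \<open>u\<close> of the
  degree-one extension of \<open>cubic\<close>, so the error is of second order in
  \<open>d = v - u\<close>, and \<open>d \<bullet> d\<close> is twice
  \<open>1 - u \<bullet> v\<close>. The constants 1/2, 1/3 and 1/6 of the three error terms add up
  to 1.\<close>

lemma cubic_minus_dual:
  assumes u: "norm u = 1" and v: "norm v = 1"
  shows "\<bar>cubic v - dual u \<bullet> v\<bar> \<le> 2 * C * (1 - u \<bullet> v)"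
proof -
  define d where "d = v - u"
  have v_eq: "v = u + d" by (simp add: d_def)
  have dd: "d \<bullet> d = 2 * (1 - u \<bullet> v)"
    using u v by (simp add: d_def inner_simps norm_eq_1 inner_commute)
  \<comment> \<open>On the sphere the radial part of \<open>d\<close> is itself of second
    order.\<close>
  have ud: "u \<bullet> d = - (d \<bullet> d) / 2"
    unfolding dd using u by (simp add: d_def inner_simps norm_eq_1)
  have nd2: "(norm d)\<^sup>2 = d \<bullet> d"
    by (simp add: power2_norm_eq_inner)
  have nd: "norm d \<le> 2"
    using norm_triangle_ineq4[of v u] u v by (simp add: d_def)
  have expand: "cubic v = cubic u + grad u \<bullet> d + (B u d \<bullet> d) / 2 + cubic d"
  proof -
    have "B d d \<bullet> u = B u d \<bullet> d" "B d u \<bullet> u = B u u \<bullet> d" "B u d \<bullet> u = B u u \<bullet> d" "B d u \<bullet> d = B u d \<bullet> d"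
      by (metis commute selfadjoint inner_commute)+
    then show ?thesis
      by (simp add: v_eq cubic_def grad_def B.add_left B.add_right inner_simps field_simps)
  qed
  have "dual u \<bullet> v = cubic u + grad u \<bullet> d + cubic u * (d \<bullet> d)"
    using u by (simp add: v_eq dual_unit inner_simps inner_grad_self norm_eq_1 ud algebra_simps)
  with expand have "cubic v - dual u \<bullet> v = (B u d \<bullet> d) / 2 + cubic d - cubic u * (d \<bullet> d)"
    by simp
  also have "\<bar>\<dots>\<bar> \<le> C * (d \<bullet> d) / 2 + C * (d \<bullet> d) / 3 + C * (d \<bullet> d) / 6"
  proof -
    have "\<bar>B u d \<bullet> d\<bar> \<le> C * (d \<bullet> d)"
      using abs_B_inner[of u d d] u by (simp add: nd2[symmetric] power2_eq_square mult.assoc)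
    moreover have "\<bar>cubic d\<bar> \<le> C * (d \<bullet> d) / 3"
    proof -
      \<comment> \<open>The chord length is at most 2, which trades one power of
        \<open>norm d\<close> for a constant and makes the cubic remainder quadratic.\<close>
      have "C * norm d ^ 3 \<le> C * ((norm d)\<^sup>2 * 2)"
        using nd C_pos by (simp add: power3_eq_cube power2_eq_square mult_left_mono)
      then show ?thesis
        using abs_cubic[of d] by (simp add: nd2)
    qed
    moreover have "\<bar>cubic u * (d \<bullet> d)\<bar> \<le> C * (d \<bullet> d) / 6"
      using mult_right_mono[OF abs_cubic[of u], of "d \<bullet> d"] u by (simp add: abs_mult)
    ultimately show ?thesis
      by linarith
  qed
  also have "\<dots> = 2 * C * (1 - u \<bullet> v)"
    by (simp add: dd field_simps)
  finally show ?thesis .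
qed

end


section \<open>The perturbed ball\<close>

text \<open>The constant 20 makes \<open>\<Phi>'\<close> differ from the identity by at most 1/2
  where \<open>norm x > r / 2\<close>: there \<open>norm_dual_deriv\<close> gives at most
  \<open>5 * (r / 20) / (r / 2)\<close>.\<close>

locale perturbed_ball = bounded_symmetric_trilinear B C
  for B :: "real^4 \<Rightarrow> real^4 \<Rightarrow> real^4" and C :: real +
  fixes r \<epsilon> :: real
  assumes r_pos: "r > 0" and small: "20 * C * \<bar>\<epsilon>\<bar> \<le> r"
begin

definition h :: "real^4 \<Rightarrow> real" where "h u = r + \<epsilon> * cubic u"

definition body :: "(real^4) set" where
  "body = {x. \<forall>u. norm u = 1 \<longrightarrow> x \<bullet> u \<le> h u}"

definition \<Phi> :: "real^4 \<Rightarrow> real^4" where "\<Phi> x = x + \<epsilon> *\<^sub>R dual x"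

definition \<Phi>' :: "real^4 \<Rightarrow> real^4 \<Rightarrow> real^4" where "\<Phi>' x v = v + \<epsilon> *\<^sub>R dual_deriv x v"

lemma perturbation_small: "C * \<bar>\<epsilon>\<bar> \<le> r / 20"
  using small by simp

lemma \<Phi>_inner_self:
  assumes "norm u = 1" "\<rho> > 0"
  shows "\<Phi> (\<rho> *\<^sub>R u) \<bullet> u = \<rho> + \<epsilon> * cubic u"
  using assms by (simp add: \<Phi>_def dual_scale inner_simps dual_inner_self norm_eq_1)

text \<open>The term \<open>\<rho> * (1 - u \<bullet> v)\<close> is the exact deficit for a ball;
  the rest is \<open>\<epsilon>\<close> times the error in \<open>cubic_minus_dual\<close>, and
  \<open>2 * C * \<bar>\<epsilon>\<bar>\<close> is at most \<open>r / 10\<close>. The radius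
  \<open>\<rho>\<close> is free because injectivity of \<open>\<Phi>\<close> compares points at
  different radii.\<close>

lemma \<Phi>_inner:
  assumes u: "norm u = 1" and v: "norm v = 1" and \<rho>: "\<rho> > 0"
  shows "\<bar>\<rho> * (1 - u \<bullet> v) - (\<rho> + \<epsilon> * cubic v - \<Phi> (\<rho> *\<^sub>R u) \<bullet> v)\<bar> \<le> r / 10 * (1 - u \<bullet> v)"
proof -
  have uv: "0 \<le> 1 - u \<bullet> v"
    using norm_cauchy_schwarz[of u v] u v by simp
  have "\<rho> * (1 - u \<bullet> v) - (\<rho> + \<epsilon> * cubic v - \<Phi> (\<rho> *\<^sub>R u) \<bullet> v) = - \<epsilon> * (cubic v - dual u \<bullet> v)"
    using \<rho> by (simp add: \<Phi>_def dual_scale inner_simps algebra_simps)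
  then have "\<bar>\<rho> * (1 - u \<bullet> v) - (\<rho> + \<epsilon> * cubic v - \<Phi> (\<rho> *\<^sub>R u) \<bullet> v)\<bar> = \<bar>\<epsilon>\<bar> * \<bar>cubic v - dual u \<bullet> v\<bar>"
    by (simp add: abs_mult)
  also have "\<dots> \<le> \<bar>\<epsilon>\<bar> * (2 * C * (1 - u \<bullet> v))"
    using cubic_minus_dual[OF u v] by (simp add: mult_left_mono)
  also have "\<dots> = (2 * (C * \<bar>\<epsilon>\<bar>)) * (1 - u \<bullet> v)"
    by simp
  also have "\<dots> \<le> r / 10 * (1 - u \<bullet> v)"
    using perturbation_small uv by (intro mult_right_mono) auto
  finally show ?thesis .
qed

lemma unit_eq_iff_inner:
  fixes u v :: "real^4"
  assumes "norm u = 1" "norm v = 1" "1 - u \<bullet> v \<le> 0"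
  shows "u = v"
proof -
  have "(u - v) \<bullet> (u - v) = 2 * (1 - u \<bullet> v)"
    using assms(1,2) by (simp add: inner_simps norm_eq_1 inner_commute)
  then have "(u - v) \<bullet> (u - v) \<le> 0"
    using assms(3) by simp
  then show ?thesis
    by (metis eq_iff_diff_eq_0 inner_ge_zero inner_eq_zero_iff order_antisym)
qed

text \<open>The upper bound places the boundary points in the body and makes normals unique; the
  lower bound makes touching points unique.\<close>

lemma \<Phi>_boundary_inner_le:
  assumes "norm u = 1" "norm v = 1"
  shows "\<Phi> (r *\<^sub>R u) \<bullet> v \<le> h v - 9 / 10 * r * (1 - u \<bullet> v)"
    and "\<Phi> (r *\<^sub>R u) \<bullet> v \<ge> h v - 11 / 10 * r * (1 - u \<bullet> v)"
proof -
  define t where "t = r * (1 - u \<bullet> v)"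
  have "\<bar>t - (h v - \<Phi> (r *\<^sub>R u) \<bullet> v)\<bar> \<le> t / 10"
    using \<Phi>_inner[OF assms r_pos] by (simp add: t_def h_def)
  then have "\<Phi> (r *\<^sub>R u) \<bullet> v \<le> h v - 9 / 10 * t" "\<Phi> (r *\<^sub>R u) \<bullet> v \<ge> h v - 11 / 10 * t"
    by linarith+
  then show "\<Phi> (r *\<^sub>R u) \<bullet> v \<le> h v - 9 / 10 * r * (1 - u \<bullet> v)"
    "\<Phi> (r *\<^sub>R u) \<bullet> v \<ge> h v - 11 / 10 * r * (1 - u \<bullet> v)"
    by (simp_all add: t_def)
qed

lemma h_bounds:
  assumes "norm u = 1"
  shows "\<bar>h u - r\<bar> \<le> C * \<bar>\<epsilon>\<bar>" "h u \<ge> r / 2" "h u \<le> 2 * r"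
proof -
  have "\<bar>cubic u\<bar> \<le> C"
    using abs_cubic[of u] C_pos assms by simp
  then have "\<bar>h u - r\<bar> \<le> \<bar>\<epsilon>\<bar> * C"
    by (simp add: h_def abs_mult mult_left_mono)
  then show 1: "\<bar>h u - r\<bar> \<le> C * \<bar>\<epsilon>\<bar>"
    by (simp add: mult.commute)
  show "h u \<ge> r / 2" "h u \<le> 2 * r"
    using 1 perturbation_small r_pos by (auto simp: abs_le_iff)
qed

lemma body_norm_le:
  assumes "x \<in> body"
  shows "norm x \<le> r + C * \<bar>\<epsilon>\<bar>"
proof (cases "x = 0")
  case False
  then have n: "norm (sgn x) = 1"
    by (simp add: norm_sgn)
  have "norm x = x \<bullet> sgn x"
    using False by (simp add: sgn_div_norm power2_norm_eq_inner[symmetric] power2_eq_square)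
  also have "\<dots> \<le> h (sgn x)"
    using assms n by (auto simp: body_def)
  also have "\<dots> \<le> r + C * \<bar>\<epsilon>\<bar>"
    using h_bounds(1)[OF n] by (simp add: abs_le_iff)
  finally show ?thesis .
qed (use r_pos C_pos in simp)

lemma cball_subset_body:
  assumes "\<rho> \<le> r - C * \<bar>\<epsilon>\<bar>"
  shows "cball 0 \<rho> \<subseteq> body"
proof
  fix x :: "real^4" assume x: "x \<in> cball 0 \<rho>"
  show "x \<in> body"
    unfolding body_def
  proof (intro CollectI allI impI)
    fix u :: "real^4" assume u: "norm u = 1"
    have "x \<bullet> u \<le> norm x * norm u"
      by (rule norm_cauchy_schwarz)
    then show "x \<bullet> u \<le> h u"
      using x u assms h_bounds(1)[OF u] by (auto simp: abs_le_iff)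
  qed
qed

lemma compact_body: "compact body"
proof -
  have "closed body"
  proof -
    have "body = (\<Inter>u\<in>sphere 0 1. {x. u \<bullet> x \<le> h u})"
      by (auto simp: body_def inner_commute)
    then show ?thesis
      by (auto intro: closed_halfspace_le)
  qed
  moreover have "bounded body"
    using body_norm_le bounded_iff by blast
  ultimately show ?thesis
    by (simp add: compact_eq_bounded_closed)
qed

lemma convex_body_body: "convex_body body"
proof -
  have "body = (\<Inter>u\<in>sphere 0 1. {x. u \<bullet> x \<le> h u})"
    by (auto simp: body_def inner_commute)
  then have "convex body"
    by (auto intro: convex_INT convex_halfspace_le)
  moreover have "interior body \<noteq> {}"
  proof -
    have "r / 2 \<le> r - C * \<bar>\<epsilon>\<bar>"
      using perturbation_small r_pos by linarith
    then have "ball 0 (r / 2) \<subseteq> body"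
      using cball_subset_body ball_subset_cball by blast
    then have "0 \<in> interior body"
      using r_pos by (meson centre_in_ball half_gt_zero interior_maximal open_ball subset_eq)
    then show ?thesis by blast
  qed
  ultimately show ?thesis
    by (simp add: convex_body_def compact_body)
qed

lemma boundary_point_in_body:
  assumes u: "norm u = 1"
  shows "\<Phi> (r *\<^sub>R u) \<in> body"
  unfolding body_def
proof (intro CollectI allI impI)
  fix v :: "real^4" assume v: "norm v = 1"
  have "0 \<le> 9 / 10 * r * (1 - u \<bullet> v)"
    using norm_cauchy_schwarz[of u v] u v r_pos by simp
  then show "\<Phi> (r *\<^sub>R u) \<bullet> v \<le> h v"
    using \<Phi>_boundary_inner_le(1)[OF u v] by linarith
qed

lemma boundary_point_inner: "norm u = 1 \<Longrightarrow> \<Phi> (r *\<^sub>R u) \<bullet> u = h u"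
  using \<Phi>_inner_self[OF _ r_pos] by (simp add: h_def)

lemma support_fun_body:
  assumes u: "norm u = 1"
  shows "support_fun body u = h u"
  unfolding support_fun_def
proof (rule cSup_eq_maximum)
  show "h u \<in> (\<lambda>x. x \<bullet> u) ` body"
    using boundary_point_inner[OF u] boundary_point_in_body[OF u] by (metis imageI)
qed (use u in \<open>auto simp: body_def\<close>)

lemma constant_width_body: "constant_width body (2 * r)"
  by (simp add: constant_width_def support_fun_body h_def cubic_minus)

text \<open>By compactness the slack \<open>h u - z \<bullet> u\<close> attains its minimum. A
  positive minimum would be the radius of a ball around \<open>z\<close> inside the body.\<close>

lemma frontier_point_touches:
  assumes "z \<in> frontier body"
  obtains u where "norm u = 1" "z \<bullet> u = h u"
proof -
  have zb: "z \<in> body" and zi: "z \<notin> interior body"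
    using assms compact_body by (auto simp: frontier_def compact_imp_closed)
  have "continuous_on (sphere 0 1) (\<lambda>u. h u - z \<bullet> u)"
    unfolding h_def
    by (intro continuous_intros has_derivative_continuous_on[OF cubic_has_derivative])
  moreover have "sphere (0::real^4) 1 \<noteq> {}"
    by simp
  ultimately obtain u where *: "u \<in> sphere 0 1" "\<forall>v\<in>sphere 0 1. h u - z \<bullet> u \<le> h v - z \<bullet> v"
    using continuous_attains_inf[OF compact_sphere, of 0 1 "\<lambda>u. h u - z \<bullet> u"] by blast
  have u: "norm u = 1" and min: "\<And>v. norm v = 1 \<Longrightarrow> h u - z \<bullet> u \<le> h v - z \<bullet> v"
    using * by auto
  have "z \<bullet> u = h u"
  proof (rule ccontr)
    assume "z \<bullet> u \<noteq> h u"
    then have m: "h u - z \<bullet> u > 0"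
      using zb u by (simp add: body_def order_less_le)
    have "ball z (h u - z \<bullet> u) \<subseteq> body"
    proof
      fix y assume y: "y \<in> ball z (h u - z \<bullet> u)"
      show "y \<in> body"
        unfolding body_def
      proof (intro CollectI allI impI)
        fix v :: "real^4" assume v: "norm v = 1"
        have "y \<bullet> v = z \<bullet> v + (y - z) \<bullet> v"
          by (simp add: inner_simps)
        also have "(y - z) \<bullet> v \<le> norm (y - z)"
          using norm_cauchy_schwarz[of "y - z" v] v by simp
        finally show "y \<bullet> v \<le> h v"
          using min[OF v] y by (simp add: dist_norm norm_minus_commute)
      qed
    qed
    then have "z \<in> interior body"
      using m by (meson centre_in_ball interior_maximal open_ball subset_eq)
    with zi show False by simp
  qed
  with u that show thesis by blast
qed

text \<open>Differentiability of the support function in quantitative form: two points touching at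
  \<open>u\<close> differ by a tangent vector \<open>y\<close>, and tilting \<open>u\<close> towards
  \<open>y\<close> gains to first order what \<open>h\<close> permits only to second order.\<close>

lemma touching_point_unique:
  assumes z: "z \<in> body" and u: "norm u = 1" and zu: "z \<bullet> u = h u"
  shows "z = \<Phi> (r *\<^sub>R u)"
proof (rule ccontr)
  assume ne: "z \<noteq> \<Phi> (r *\<^sub>R u)"
  define y where "y = z - \<Phi> (r *\<^sub>R u)"
  have y: "norm y > 0" "y \<bullet> u = 0"
    using ne boundary_point_inner[OF u] zu by (simp_all add: y_def inner_simps)
  \<comment> \<open>\<open>(1 - a * \<beta>, \<beta>)\<close> is the rational parametrization of the circle, so \<open>v\<close> is a unit vector close to \<open>u\<close>
    at which the first-order term in \<open>y\<close> would exceed the second-order bound.\<close>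
  define a where "a = norm y / (4 * r)"
  define \<beta> where "\<beta> = 2 * a / (1 + a\<^sup>2)"
  define v where "v = (1 - a * \<beta>) *\<^sub>R u + \<beta> *\<^sub>R sgn y"
  have a: "a > 0" and den: "1 + a\<^sup>2 > 0"
    using y r_pos by (simp_all add: a_def add_pos_nonneg)
  then have \<beta>: "\<beta> > 0" by (simp add: \<beta>_def)
  have yy: "y \<bullet> y = norm y * norm y"
    by (simp flip: power2_norm_eq_inner power2_eq_square)
  have sy: "sgn y \<bullet> sgn y = 1" "sgn y \<bullet> u = 0" "u \<bullet> sgn y = 0" "y \<bullet> sgn y = norm y"
    using y by (simp_all add: sgn_div_norm yy inner_commute field_simps)
  have "v \<bullet> v = (1 - a * \<beta>)\<^sup>2 + \<beta>\<^sup>2"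
    using u by (simp add: v_def inner_simps sy norm_eq_1 power2_eq_square)
  also have "\<dots> = 1 + \<beta> * (\<beta> * (1 + a\<^sup>2) - 2 * a)"
    by (simp add: power2_eq_square algebra_simps)
  also have "\<beta> * (1 + a\<^sup>2) - 2 * a = 0"
    using den by (simp add: \<beta>_def)
  finally have v: "norm v = 1"
    by (simp add: norm_eq_1)
  have uv: "1 - u \<bullet> v = a * \<beta>" and yv: "y \<bullet> v = \<beta> * norm y"
    using u y by (simp_all add: v_def inner_simps sy norm_eq_1)
  have "z \<bullet> v \<le> h v"
    using z v by (simp add: body_def)
  then have "y \<bullet> v \<le> 11 / 10 * r * (1 - u \<bullet> v)"
    using \<Phi>_boundary_inner_le(2)[OF u v] by (simp add: y_def inner_simps)
  then have "\<beta> * norm y \<le> \<beta> * (11 / 10 * r * a)"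
    by (simp add: uv yv algebra_simps)
  then have "norm y \<le> 11 / 10 * r * a"
    using \<beta> by simp
  \<comment> \<open>By the choice of \<open>a\<close> the right-hand side is 11/40 of
    \<open>norm y\<close>.\<close>
  then show False
    using y(1) r_pos by (simp add: a_def)
qed

lemma frontier_body: "frontier body = (\<lambda>u. \<Phi> (r *\<^sub>R u)) ` sphere 0 1"
proof (intro equalityI subsetI)
  fix z assume z: "z \<in> frontier body"
  then have "z \<in> body"
    using compact_body by (simp add: frontier_def compact_imp_closed)
  moreover obtain u where "norm u = 1" "z \<bullet> u = h u"
    using frontier_point_touches[OF z] by blast
  ultimately show "z \<in> (\<lambda>u. \<Phi> (r *\<^sub>R u)) ` sphere 0 1"
    using touching_point_unique by (intro image_eqI) auto
next
  fix z assume "z \<in> (\<lambda>u. \<Phi> (r *\<^sub>R u)) ` sphere 0 1"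
  then obtain u where u: "norm u = 1" and z: "z = \<Phi> (r *\<^sub>R u)"
    by auto
  have "z \<notin> interior body"
  proof
    assume "z \<in> interior body"
    then obtain e where e: "e > 0" "ball z e \<subseteq> body"
      by (meson mem_interior)
    then have "z + (e / 2) *\<^sub>R u \<in> body"
      using u by (auto simp: dist_norm)
    then have "(z + (e / 2) *\<^sub>R u) \<bullet> u \<le> h u"
      using u by (simp add: body_def)
    then show False
      using e(1) boundary_point_inner[OF u] u by (simp add: z inner_simps norm_eq_1)
  qed
  then show "z \<in> frontier body"
    using boundary_point_in_body[OF u] z closure_subset by (auto simp: frontier_def)
qed

lemma outer_normal_body:
  assumes u: "norm u = 1"
  shows "outer_normal body (\<Phi> (r *\<^sub>R u)) = u"
  unfolding outer_normal_def
proof (rule the_equality)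
  show "norm u = 1 \<and> (\<forall>x\<in>body. (x - \<Phi> (r *\<^sub>R u)) \<bullet> u \<le> 0)"
    using u boundary_point_inner[OF u] by (auto simp: inner_simps body_def)
next
  fix n assume n: "norm n = 1 \<and> (\<forall>x\<in>body. (x - \<Phi> (r *\<^sub>R u)) \<bullet> n \<le> 0)"
  \<comment> \<open>A normal \<open>n\<close> is tested on the boundary point
    \<open>\<Phi> (r *\<^sub>R n)\<close>, where the value \<open>h n\<close> is attained; the
    deficit bound then leaves only \<open>n = u\<close>.\<close>
  then have "h n \<le> \<Phi> (r *\<^sub>R u) \<bullet> n"
    using boundary_point_in_body[of n] boundary_point_inner[of n] by (auto simp: inner_simps)
  then have "9 / 10 * r * (1 - u \<bullet> n) \<le> 0"
    using \<Phi>_boundary_inner_le(1)[OF u, of n] n by linarith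
  then have "1 - u \<bullet> n \<le> 0"
    using r_pos by (simp add: mult_le_0_iff)
  then show "n = u"
    using unit_eq_iff_inner[of u n] u n by auto
qed

lemma hausdorff_dist_body: "hausdorff_dist body (cball 0 r) \<le> C * \<bar>\<epsilon>\<bar>"
proof -
  let ?\<eta> = "C * \<bar>\<epsilon>\<bar>"
  have \<eta>: "0 \<le> ?\<eta>" "?\<eta> \<le> r"
    using C_pos perturbation_small r_pos by auto
  have "(SUP a\<in>body. infdist a (cball 0 r)) \<le> ?\<eta>"
  proof (rule cSUP_least)
    show "body \<noteq> {}"
      using boundary_point_in_body[of "axis 1 1"] by auto
    fix x assume x: "x \<in> body"
    show "infdist x (cball 0 r) \<le> ?\<eta>"
    proof (cases "norm x \<le> r")
      case False
      then have n: "norm x > 0"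
        using r_pos by linarith
      have "infdist x (cball 0 r) \<le> dist x (r *\<^sub>R sgn x)"
        by (rule infdist_le) (use r_pos n in \<open>simp add: norm_sgn\<close>)
      also have "x - r *\<^sub>R sgn x = (norm x - r) *\<^sub>R sgn x"
        using n by (simp add: sgn_div_norm algebra_simps)
      then have "dist x (r *\<^sub>R sgn x) = norm x - r"
        using False n by (simp add: dist_norm norm_sgn)
      finally show ?thesis
        using body_norm_le[OF x] by simp
    qed (use \<eta> in simp)
  qed
  moreover have "(SUP b\<in>cball 0 r. infdist b body) \<le> ?\<eta>"
  proof (rule cSUP_least)
    show "cball (0::real^4) r \<noteq> {}"
      using r_pos by simp
    fix x :: "real^4" assume x: "x \<in> cball 0 r"
    \<comment> \<open>Radial shrinking by this factor lands in the concentric ball of radius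
      \<open>r - ?\<eta>\<close>, which lies in the body, and moves \<open>x\<close> by at most
      \<open>?\<eta>\<close>.\<close>
    have "norm ((1 - ?\<eta> / r) *\<^sub>R x) = (1 - ?\<eta> / r) * norm x"
      using \<eta> r_pos by simp
    also have "\<dots> \<le> (1 - ?\<eta> / r) * r"
      using x \<eta> r_pos by (intro mult_left_mono) auto
    also have "\<dots> = r - ?\<eta>"
      using r_pos by (simp add: field_simps)
    finally have "(1 - ?\<eta> / r) *\<^sub>R x \<in> body"
      using cball_subset_body[of "r - ?\<eta>"] by auto
    then have "infdist x body \<le> dist x ((1 - ?\<eta> / r) *\<^sub>R x)"
      by (rule infdist_le)
    also have "\<dots> = ?\<eta> / r * norm x"
      using \<eta> r_pos by (simp add: dist_norm algebra_simps)
    also have "\<dots> \<le> ?\<eta> / r * r"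
      using x \<eta> r_pos by (intro mult_left_mono) auto
    finally show "infdist x body \<le> ?\<eta>"
      using r_pos by simp
  qed
  ultimately show ?thesis
    by (simp add: hausdorff_dist_def)
qed

end


section \<open>Smoothness and curvature of the perturbed ball\<close>

lemma Cn_on_bounded_linear:
  assumes "open U" "bounded_linear f"
  shows "Cn_on n f U"
\<comment> \<open>Proving one order more and then lowering it avoids a separate case for order
  0.\<close>
proof (rule Cn_on_lower, rule Cn_on_SucI[OF assms(1)])
  show "(f has_derivative f) (at x)" for x
    by (rule bounded_linear_imp_has_derivative[OF assms(2)])
qed (rule Cn_on_const[OF assms(1)])

lemma (in symmetric_trilinear) Cn_on_grad: "open U \<Longrightarrow> Cn_on n (\<lambda>x. grad x \<bullet> w) U"
  by (rule Cn_on_lower, rule Cn_on_SucI[where f' = "\<lambda>x v. B x v \<bullet> w"])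
     (auto intro!: derivative_eq_intros Cn_on_bounded_linear bounded_linear_inner_left_comp B.bounded_linear_left)

lemma (in symmetric_trilinear) Cn_on_cubic: "open U \<Longrightarrow> Cn_on n cubic U"
  by (rule Cn_on_lower, rule Cn_on_SucI) (auto intro: cubic_has_derivative Cn_on_grad)

lemma (in symmetric_trilinear) Cn_on_dual:
  assumes U: "open U" and "0 \<notin> U"
  shows "Cn_on n (\<lambda>x. dual x \<bullet> w) U"
proof (rule Cn_on_cong[OF U])
  have inv: "Cn_on n (\<lambda>x. inverse (\<Sum>b\<in>Basis. (x \<bullet> b) * (x \<bullet> b))) U"
    using assms(2)
    by (intro Cn_on_inverse[OF U] Cn_on_sum[OF U] Cn_on_mult[OF U] Cn_on_inner[OF U])
       (metis euclidean_inner inner_eq_zero_iff)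
  then show "Cn_on n (\<lambda>x. inverse (\<Sum>b\<in>Basis. (x \<bullet> b) * (x \<bullet> b)) * (grad x \<bullet> w)
      + (- 2) * (cubic x * (inverse (\<Sum>b\<in>Basis. (x \<bullet> b) * (x \<bullet> b))
          * (inverse (\<Sum>b\<in>Basis. (x \<bullet> b) * (x \<bullet> b)) * (x \<bullet> w)))) ) U"
    by (intro Cn_on_add[OF U] Cn_on_mult[OF U] Cn_on_grad[OF U] Cn_on_cubic[OF U] Cn_on_const[OF U] Cn_on_inner[OF U])
  fix x :: 'a
  show "inverse (\<Sum>b\<in>Basis. (x \<bullet> b) * (x \<bullet> b)) * (grad x \<bullet> w)
      + (- 2) * (cubic x * (inverse (\<Sum>b\<in>Basis. (x \<bullet> b) * (x \<bullet> b))
          * (inverse (\<Sum>b\<in>Basis. (x \<bullet> b) * (x \<bullet> b)) * (x \<bullet> w)))) = dual x \<bullet> w"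
    by (simp add: euclidean_inner[of x x, symmetric] dual_def inner_simps divide_inverse power2_eq_square)
qed

context perturbed_ball
begin

text \<open>An unbounded exterior region: the derivative of \<open>dual\<close> decays like the
  reciprocal of the norm, so only the origin has to be kept away.\<close>

definition annulus :: "(real^4) set" where "annulus = {x. r / 2 < norm x}"

lemma open_annulus: "open annulus"
  unfolding annulus_def by (intro open_Collect_less continuous_intros)

lemma annulus_nonzero: "x \<in> annulus \<Longrightarrow> x \<noteq> 0"
  using r_pos by (auto simp: annulus_def)

lemma sphere_in_annulus: "norm u = 1 \<Longrightarrow> r *\<^sub>R u \<in> annulus"
  using r_pos by (simp add: annulus_def)

text \<open>The region is not convex, so a derivative close to the identity does not give
  injectivity at once. Instead, testing \<open>\<Phi> x = \<Phi> y\<close> against the direction of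
  \<open>y\<close> bounds \<open>norm y\<close> by \<open>norm x\<close> minus a positive multiple
  of \<open>1 - sgn x \<bullet> sgn y\<close>. By symmetry the norms agree, and then so do the
  directions.\<close>

lemma \<Phi>_inj: "inj_on \<Phi> annulus"
proof (rule inj_onI)
  fix x y assume xy: "x \<in> annulus" "y \<in> annulus" and eq: "\<Phi> x = \<Phi> y"
  have key: "norm y \<le> norm x - (norm x - r / 10) * (1 - sgn x \<bullet> sgn y)"
    if "x \<in> annulus" "y \<in> annulus" "\<Phi> x = \<Phi> y" for x y
  proof -
    have pos: "norm x > 0" "norm y > 0"
      using that annulus_nonzero by auto
    then have sx: "norm (sgn x) = 1" "norm x *\<^sub>R sgn x = x" and sy: "norm (sgn y) = 1" "norm y *\<^sub>R sgn y = y"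
      by (simp_all add: norm_sgn sgn_div_norm)
    have "norm y + \<epsilon> * cubic (sgn y) = \<Phi> x \<bullet> sgn y"
      using \<Phi>_inner_self[OF sy(1) pos(2)] that(3) sy(2) by simp
    moreover define t where "t = 1 - sgn x \<bullet> sgn y"
    moreover have "\<bar>norm x * t - (norm x + \<epsilon> * cubic (sgn y) - \<Phi> x \<bullet> sgn y)\<bar> \<le> r / 10 * t"
      using \<Phi>_inner[OF sx(1) sy(1) pos(1)] sx(2) by (simp add: t_def)
    ultimately have "norm y \<le> norm x - (norm x * t - r / 10 * t)"
      by linarith
    then show ?thesis
      unfolding t_def left_diff_distrib .
  qed
  have pos: "norm x > 0" "norm y > 0"
    using xy annulus_nonzero by auto
  then have sgn: "norm (sgn x) = 1" "norm (sgn y) = 1"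
    by (simp_all add: norm_sgn)
  then have nonneg: "0 \<le> 1 - sgn x \<bullet> sgn y"
    using norm_cauchy_schwarz[of "sgn x" "sgn y"] by simp
  have ge: "norm x - r / 10 > 0" "norm y - r / 10 > 0"
    using xy r_pos by (simp_all add: annulus_def)
  have 1: "norm y \<le> norm x - (norm x - r / 10) * (1 - sgn x \<bullet> sgn y)"
    by (rule key[OF xy eq])
  have 2: "norm x \<le> norm y - (norm y - r / 10) * (1 - sgn x \<bullet> sgn y)"
    using key[OF xy(2,1) eq[symmetric]] by (simp add: inner_commute)
  have prods: "0 \<le> (norm x - r / 10) * (1 - sgn x \<bullet> sgn y)" "0 \<le> (norm y - r / 10) * (1 - sgn x \<bullet> sgn y)"
    using ge nonneg by simp_all
  then have n: "norm x = norm y" and "(norm x - r / 10) * (1 - sgn x \<bullet> sgn y) \<le> 0"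
    using 1 2 by linarith+
  then have "1 - sgn x \<bullet> sgn y \<le> 0"
    using ge(1) by (simp add: mult_le_0_iff)
  then have "sgn x = sgn y"
    by (rule unit_eq_iff_inner[OF sgn])
  moreover have "x = norm x *\<^sub>R sgn x" "y = norm y *\<^sub>R sgn y"
    using pos by (simp_all add: sgn_div_norm)
  ultimately show "x = y"
    using n by simp
qed

lemma \<Phi>_has_derivative: "x \<noteq> 0 \<Longrightarrow> (\<Phi> has_derivative \<Phi>' x) (at x)"
  unfolding \<Phi>_def[abs_def] \<Phi>'_def[abs_def] by (auto intro!: derivative_eq_intros dual_has_derivative)

lemma \<Phi>'_near_identity:
  assumes "x \<in> annulus"
  shows "norm (\<Phi>' x v - v) \<le> norm v / 2"
proof -
  have x: "norm x > r / 2" "x \<noteq> 0"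
    using assms annulus_nonzero by (auto simp: annulus_def)
  have "norm (\<Phi>' x v - v) = \<bar>\<epsilon>\<bar> * norm (dual_deriv x v)"
    by (simp add: \<Phi>'_def)
  also have "\<dots> \<le> \<bar>\<epsilon>\<bar> * (5 * C * norm v / norm x)"
    by (rule mult_left_mono[OF norm_dual_deriv[OF x(2)] abs_ge_zero])
  also have "\<dots> = 5 * (C * \<bar>\<epsilon>\<bar>) * norm v / norm x"
    by simp
  also have "\<dots> \<le> 5 * (r / 20) * norm v / norm x"
    using perturbation_small by (intro divide_right_mono mult_right_mono) auto
  also have "\<dots> \<le> norm v / 2"
  proof -
    have "r * norm v \<le> (2 * norm x) * norm v"
      using x by (intro mult_right_mono) auto
    then show ?thesis
      using x by (simp add: field_simps)
  qed
  finally show ?thesis .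
qed

lemma \<Phi>'_expands:
  assumes "x \<in> annulus"
  shows "norm (\<Phi>' x v) \<ge> 1 / 2 * norm v" "v \<bullet> \<Phi>' x v \<ge> (norm v)\<^sup>2 / 2"
proof -
  show "norm (\<Phi>' x v) \<ge> 1 / 2 * norm v"
    using \<Phi>'_near_identity[OF assms, of v] norm_triangle_ineq2[of v "\<Phi>' x v"]
    by (simp add: norm_minus_commute)
  have "v \<bullet> (v - \<Phi>' x v) \<le> norm v * norm (v - \<Phi>' x v)"
    by (rule norm_cauchy_schwarz)
  also have "\<dots> \<le> norm v * (norm v / 2)"
    using \<Phi>'_near_identity[OF assms, of v] by (intro mult_left_mono) (auto simp: norm_minus_commute)
  finally show "v \<bullet> \<Phi>' x v \<ge> (norm v)\<^sup>2 / 2"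
    by (simp add: inner_simps power2_norm_eq_inner[symmetric] power2_eq_square)
qed

lemma linear_\<Phi>': "linear (\<Phi>' x)"
  unfolding \<Phi>'_def using linear_dual_deriv
  by (intro linearI) (simp_all add: linear_add linear_scale algebra_simps)

lemma \<Phi>'_symmetric: "\<Phi>' x v \<bullet> w = v \<bullet> \<Phi>' x w"
  by (simp add: \<Phi>'_def inner_simps dual_deriv_selfadjoint)

lemma \<Phi>'_self: "x \<noteq> 0 \<Longrightarrow> \<Phi>' x x = x"
  by (simp add: \<Phi>'_def dual_deriv_self)

section \<open>The smooth inverse of the perturbation and the defining function of the
  boundary\<close>

definition V :: "(real^4) set" where "V = \<Phi> ` annulus"

definition G :: "real^4 \<Rightarrow> real^4" where "G = the_inv_into annulus \<Phi>"

definition G' :: "real^4 \<Rightarrow> real^4 \<Rightarrow> real^4" where "G' z = inv (\<Phi>' (G z))"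

lemma continuous_\<Phi>: "continuous_on annulus \<Phi>"
  using \<Phi>_has_derivative annulus_nonzero
  by (meson continuous_at_imp_continuous_on has_derivative_continuous)

lemma open_V: "open V"
  unfolding V_def by (rule invariance_of_domain[OF continuous_\<Phi> open_annulus \<Phi>_inj])

lemma G_in_annulus: "z \<in> V \<Longrightarrow> G z \<in> annulus"
  unfolding V_def G_def using \<Phi>_inj by (blast intro: the_inv_into_into)

lemma \<Phi>_G: "z \<in> V \<Longrightarrow> \<Phi> (G z) = z"
  unfolding V_def G_def using \<Phi>_inj by (simp add: f_the_inv_into_f)

lemma G_\<Phi>: "x \<in> annulus \<Longrightarrow> G (\<Phi> x) = x"
  unfolding G_def using \<Phi>_inj by (simp add: the_inv_into_f_f)

lemma \<Phi>'_G': "z \<in> V \<Longrightarrow> \<Phi>' (G z) (G' z v) = v" and G'_\<Phi>': "z \<in> V \<Longrightarrow> G' z (\<Phi>' (G z) v) = v"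
  and linear_G': "z \<in> V \<Longrightarrow> linear (G' z)"
  unfolding G'_def
  by (rule linear_inverse_of_expansion[OF linear_\<Phi>', of "1 / 2"]; use \<Phi>'_expands(1)[OF G_in_annulus] in simp)+

lemma G_has_derivative:
  assumes z: "z \<in> V"
  shows "(G has_derivative G' z) (at z)"
proof (rule has_derivative_inverse_basic)
  show "(\<Phi> has_derivative \<Phi>' (G z)) (at (G z))"
    using G_in_annulus[OF z] annulus_nonzero by (intro \<Phi>_has_derivative) auto
  show "bounded_linear (G' z)"
    using linear_G'[OF z] by (simp add: linear_conv_bounded_linear)
  show "G' z \<circ> \<Phi>' (G z) = id"
    using G'_\<Phi>'[OF z] by (simp add: fun_eq_iff)
  have "continuous_on V G"
    unfolding V_def
    by (rule continuous_on_inverse_open[OF open_annulus continuous_\<Phi>]) (auto simp: G_\<Phi>)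
  then show "continuous (at z) G"
    using open_V z by (simp add: continuous_on_eq_continuous_at)
qed (use open_V z \<Phi>_G in auto)

lemma Cn_on_G: "Cn_on n (\<lambda>z. G z $ i) V"
proof (rule Cn_on_inverse_map[OF open_V])
  show "G ` V \<subseteq> annulus"
    using G_in_annulus by auto
  show "Cn_on n (\<lambda>x. \<Phi> x $ i) annulus" for n i
  proof (rule Cn_on_cong[OF open_annulus])
    show "Cn_on n (\<lambda>x. x \<bullet> axis i 1 + \<epsilon> * (dual x \<bullet> axis i 1)) annulus"
      using annulus_nonzero
      by (intro Cn_on_add Cn_on_mult Cn_on_inner Cn_on_const Cn_on_dual open_annulus) auto
  qed (simp add: \<Phi>_def inner_axis)
  show "(\<Phi> has_derivative \<Phi>' x) (at x)" if "x \<in> annulus" for x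
    using that annulus_nonzero by (intro \<Phi>_has_derivative) auto
qed (use G_has_derivative \<Phi>'_G' in auto)

lemma frontier_subset_V: "frontier body \<subseteq> V"
  using sphere_in_annulus by (auto simp: frontier_body V_def)

lemma frontier_body_iff_norm_G: "z \<in> V \<Longrightarrow> z \<in> frontier body \<longleftrightarrow> norm (G z) = r"
proof
  assume "z \<in> frontier body"
  then show "norm (G z) = r"
    using r_pos by (auto simp: frontier_body G_\<Phi> sphere_in_annulus)
next
  assume "z \<in> V" "norm (G z) = r"
  then have "z = \<Phi> (r *\<^sub>R ((1 / r) *\<^sub>R G z))" "norm ((1 / r) *\<^sub>R G z) = 1"
    using r_pos by (simp_all add: \<Phi>_G)
  then show "z \<in> frontier body"
    unfolding frontier_body by (intro image_eqI[where x = "(1 / r) *\<^sub>R G z"]) auto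
qed

lemma Ck_hypersurface_frontier: "Ck_hypersurface k (frontier body)"
  unfolding Ck_hypersurface_def
proof
  fix p assume p: "p \<in> frontier body"
  let ?F = "\<lambda>z. (\<Sum>i\<in>UNIV. G z $ i * G z $ i) + - r\<^sup>2"
  have F_eq: "?F z = (norm (G z))\<^sup>2 - r\<^sup>2" for z
    by (simp add: power2_norm_eq_inner inner_vec_def)
  have "Ck_on k ?F V"
    unfolding Ck_on_def
    by (intro allI impI Cn_on_add Cn_on_sum Cn_on_mult Cn_on_const Cn_on_G open_V)
  moreover have "\<exists>v. frechet_derivative ?F (at z) v \<noteq> 0" if z: "z \<in> V" for z
  proof -
    have "?F = (\<lambda>z. G z \<bullet> G z - r\<^sup>2)"
      by (simp add: inner_vec_def)
    moreover have "((\<lambda>z. G z \<bullet> G z - r\<^sup>2) has_derivative (\<lambda>v. G z \<bullet> G' z v + G' z v \<bullet> G z)) (at z)"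
      by (auto intro!: derivative_eq_intros G_has_derivative[OF z])
    ultimately have "(?F has_derivative (\<lambda>v. G z \<bullet> G' z v + G' z v \<bullet> G z)) (at z)"
      by (simp only:)
    then have "frechet_derivative ?F (at z) = (\<lambda>v. G z \<bullet> G' z v + G' z v \<bullet> G z)"
      by (rule frechet_derivative_at[symmetric])
    \<comment> \<open>The test direction is the one that \<open>G' z\<close> maps to
      \<open>G z\<close>, the radial direction in the source.\<close>
    then have "frechet_derivative ?F (at z) (\<Phi>' (G z) (G z)) = 2 * (G z \<bullet> G z)"
      by (simp add: G'_\<Phi>'[OF z])
    also have "\<dots> \<noteq> 0"
      using G_in_annulus[OF z] annulus_nonzero by simp
    finally show ?thesis by blast
  qed
  moreover have "frontier body \<inter> V = {x \<in> V. ?F x = 0}"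
    unfolding F_eq using frontier_body_iff_norm_G r_pos by (auto simp: power2_eq_iff_nonneg)
  ultimately show "\<exists>U F. open U \<and> p \<in> U \<and> Ck_on k F U \<and>
      (\<forall>x\<in>U. \<exists>v. frechet_derivative F (at x) v \<noteq> 0) \<and> frontier body \<inter> U = {x \<in> U. F x = 0}"
    using open_V subsetD[OF frontier_subset_V p] by (intro exI[of _ V] exI[of _ ?F] conjI ballI)
qed

lemma smooth_body_body: "smooth_body body"
  by (simp add: smooth_body_def convex_body_body Ck_hypersurface_frontier)

text \<open>On the boundary the Gauss map is \<open>G z /\<^sub>R r\<close>, but its derivative
  within the boundary is known only along curves in it. The image under \<open>\<Phi>\<close> of a
  great circle through \<open>r *\<^sub>R u\<close> is such a curve, with velocity a multiple of
  \<open>v\<close>.\<close>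

lemma outer_normal_derivative:
  assumes u: "norm u = 1" and v: "v \<bullet> u = 0" and p: "p = \<Phi> (r *\<^sub>R u)"
  shows "frechet_derivative (outer_normal body) (at p within frontier body) v = G' p v /\<^sub>R r"
proof -
  let ?N = "outer_normal body" and ?L = "\<lambda>v. G' p v /\<^sub>R r"
  let ?D = "frechet_derivative ?N (at p within frontier body)"
  have pf: "p \<in> frontier body" and pV: "p \<in> V" and Gp: "G p = r *\<^sub>R u"
    using u p sphere_in_annulus[OF u] by (auto simp: frontier_body V_def G_\<Phi>)
  have ru: "r *\<^sub>R u \<noteq> 0"
    using u r_pos by auto
  have "((\<lambda>z. G z /\<^sub>R r) has_derivative ?L) (at p within frontier body)"
    by (auto intro!: derivative_eq_intros has_derivative_at_withinI[OF G_has_derivative[OF pV]])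
  then have L: "(?N has_derivative ?L) (at p within frontier body)"
  proof (rule has_derivative_transform[OF pf, rotated])
    fix z assume "z \<in> frontier body"
    then obtain u' where "norm u' = 1" "z = \<Phi> (r *\<^sub>R u')"
      by (auto simp: frontier_body)
    then show "?N z = G z /\<^sub>R r"
      using r_pos by (simp add: outer_normal_body G_\<Phi> sphere_in_annulus)
  qed
  then have D: "(?N has_derivative ?D) (at p within frontier body)"
    by (metis differentiableI frechet_derivative_works)
  show ?thesis
  proof (cases "v = 0")
    case True
    then show ?thesis
      using linear_0[OF has_derivative_linear[OF D]] linear_0[OF has_derivative_linear[OF L]] by simp
  next
    case False
    define w where "w = G' p v"
    have \<Phi>w: "\<Phi>' (r *\<^sub>R u) w = v"
      using \<Phi>'_G'[OF pV] by (simp add: w_def Gp)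
    \<comment> \<open>The preimage \<open>w\<close> of the tangent vector \<open>v\<close> is again
      tangent: \<open>\<Phi>'\<close> is symmetric and fixes the radial direction.\<close>
    have "w \<bullet> (r *\<^sub>R u) = w \<bullet> \<Phi>' (r *\<^sub>R u) (r *\<^sub>R u)"
      by (simp add: \<Phi>'_self[OF ru])
    also have "\<dots> = v \<bullet> (r *\<^sub>R u)"
      by (simp add: \<Phi>'_symmetric[symmetric] \<Phi>w)
    finally have wu: "w \<bullet> u = 0"
      using v r_pos by simp
    have w0: "w \<noteq> 0"
      using False \<Phi>w linear_0[OF linear_\<Phi>'] by auto
    then have sw: "norm (sgn w) = 1" "sgn w \<bullet> u = 0"
      using wu by (simp_all add: norm_sgn sgn_div_norm)
    \<comment> \<open>The great circle has velocity \<open>r *\<^sub>R sgn w\<close>, so its image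
      has velocity \<open>k *\<^sub>R v\<close>; linearity removes \<open>k\<close> at the
      end.\<close>
    define k where "k = r / norm w"
    have k: "k \<noteq> 0"
      using w0 r_pos by (simp add: k_def)
    define c where "c t = \<Phi> (r *\<^sub>R (cos t *\<^sub>R u + sin t *\<^sub>R sgn w))" for t
    have c0: "c 0 = p"
      by (simp add: c_def p)
    have "((\<lambda>t. r *\<^sub>R (cos t *\<^sub>R u + sin t *\<^sub>R sgn w)) has_derivative (\<lambda>t. t *\<^sub>R (r *\<^sub>R sgn w))) (at 0)"
      using great_circle_has_vector_derivative[of u "sgn w"]
      by (auto intro!: derivative_eq_intros simp: has_vector_derivative_def algebra_simps)
    moreover have "(\<Phi> has_derivative \<Phi>' (r *\<^sub>R u)) (at (r *\<^sub>R (cos 0 *\<^sub>R u + sin 0 *\<^sub>R sgn w)))"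
      using \<Phi>_has_derivative[OF ru] by simp
    ultimately have "(c has_derivative (\<lambda>t. \<Phi>' (r *\<^sub>R u) (t *\<^sub>R (r *\<^sub>R sgn w)))) (at 0)"
      unfolding c_def by (rule has_derivative_compose)
    moreover have "\<Phi>' (r *\<^sub>R u) (t *\<^sub>R (r *\<^sub>R sgn w)) = t *\<^sub>R (k *\<^sub>R v)" for t
    proof -
      have "t *\<^sub>R (r *\<^sub>R sgn w) = (t * k) *\<^sub>R w"
        by (simp add: sgn_div_norm k_def divide_inverse)
      then show ?thesis
        using linear_scale[OF linear_\<Phi>'] \<Phi>w by simp
    qed
    ultimately have "(c has_vector_derivative k *\<^sub>R v) (at 0)"
      by (simp add: has_vector_derivative_def)
    moreover have "c t \<in> frontier body" for t
      using norm_great_circle[OF u sw] by (auto simp: c_def frontier_body)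
    ultimately have "?D (k *\<^sub>R v) = ?L (k *\<^sub>R v)"
      using D L c0
      by (intro has_derivative_unique_along_curve[where f = ?N and c = c and A = ?D and A' = ?L
            and S = "frontier body"]) auto
    then have "k *\<^sub>R ?D v = k *\<^sub>R ?L v"
      using linear_scale[OF has_derivative_linear[OF D], of k v]
        linear_scale[OF has_derivative_linear[OF L], of k v] by (simp only:)
    then show ?thesis
      by (rule scaleR_left_imp_eq[OF k])
  qed
qed

text \<open>The quadratic form of the Weingarten map at \<open>y\<close> is
  \<open>w \<bullet> \<Phi>' (G p) w / r\<close> with \<open>w = G' p y\<close>, and
  \<open>\<Phi>'_expands\<close> bounds it below by a positive multiple of the squared norm of
  \<open>w\<close>.\<close>

lemma gauss_curvature_pos:
  assumes "p \<in> frontier body"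
  shows "gauss_curvature body p > 0"
proof -
  obtain u where u: "norm u = 1" and p: "p = \<Phi> (r *\<^sub>R u)"
    using assms by (auto simp: frontier_body)
  have pV: "p \<in> V"
    using assms frontier_subset_V by blast
  define e where "e = quaternion_frame u"
  have e: "orthonormal_frame u e"
    unfolding e_def by (rule quaternion_frame_orthonormal[OF u])
  define L where "L v = G' p v /\<^sub>R r" for v
  have linL: "linear L"
    unfolding L_def using linear_G'[OF pV] by (intro linearI) (simp_all add: linear_add linear_scale algebra_simps)
  define M :: "real^3^3" where "M = (\<chi> i j. (e $ i) \<bullet> L (e $ j))"
  have "gauss_curvature body p = det M"
    unfolding gauss_curvature_def M_def p outer_normal_body[OF u]
    by (rule tangent_det_eq[OF u e linL]) (simp add: L_def outer_normal_derivative[OF u _ refl] p)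
  also have "det M > 0"
  proof (rule det_pos_if_positive_definite)
    fix x :: "real^3" assume x: "x \<noteq> 0"
    define y where "y = (\<Sum>i\<in>UNIV. x $ i *\<^sub>R (e $ i))"
    have "y \<bullet> y = x \<bullet> x"
    proof -
      have ee: "(e $ i) \<bullet> (e $ j) = (if i = j then 1 else 0)" for i j
        using e by (simp add: orthonormal_frame_def)
      show ?thesis
        unfolding y_def inner_vec_def[of x]
        by (simp add: inner_sum_left inner_sum_right ee if_distrib cong: if_cong)
    qed
    with x have y: "y \<noteq> 0"
      by auto
    have "L y = (\<Sum>j\<in>UNIV. x $ j *\<^sub>R L (e $ j))"
      by (simp add: y_def linear_sum[OF linL] linear_scale[OF linL])
    then have "(M *v x) $ i = (e $ i) \<bullet> L y" for i
      by (simp add: M_def matrix_vector_mult_def inner_sum_right mult.commute)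
    then have "x \<bullet> (M *v x) = (\<Sum>i\<in>UNIV. x $ i *\<^sub>R (e $ i)) \<bullet> L y"
      by (simp add: inner_vec_def[of x] inner_sum_left)
    then have "x \<bullet> (M *v x) = y \<bullet> L y"
      by (simp add: y_def)
    also have "\<dots> = (G' p y \<bullet> \<Phi>' (G p) (G' p y)) / r"
      by (simp add: L_def \<Phi>'_G'[OF pV] inner_commute divide_inverse)
    also have "\<dots> > 0"
    proof -
      have "G' p y \<noteq> 0"
        using y \<Phi>'_G'[OF pV, of y] linear_0[OF linear_\<Phi>'] by auto
      then have "0 < (norm (G' p y))\<^sup>2 / 2"
        by simp
      also have "\<dots> \<le> G' p y \<bullet> \<Phi>' (G p) (G' p y)"
        by (rule \<Phi>'_expands(2)[OF G_in_annulus[OF pV]])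
      finally show ?thesis
        using r_pos by simp
    qed
    finally show "x \<bullet> (M *v x) > 0" .
  qed
  finally show ?thesis .
qed

lemma C2_plus_body_body: "C2_plus_body body"
  by (simp add: C2_plus_body_def convex_body_body Ck_hypersurface_frontier gauss_curvature_pos)

end

text \<open>\<open>C\<close> is fixed before \<open>r\<close> and \<open>\<epsilon>\<close>, and the
  same \<open>C\<close> bounds the Hausdorff distance; this gives bodies arbitrarily close to the
  ball.\<close>

lemma constant_width_perturbation:
  fixes B :: "real^4 \<Rightarrow> real^4 \<Rightarrow> real^4"
  assumes B: "symmetric_trilinear B"
    and q: "\<And>u. norm u = 1 \<Longrightarrow> q u = symmetric_trilinear.cubic B u"
  obtains C where "C > 0"
    "\<And>r \<epsilon>. r > 0 \<Longrightarrow> 20 * C * \<bar>\<epsilon>\<bar> \<le> r \<Longrightarrow>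
      \<exists>K. is_support_fun_of (\<lambda>u. r + \<epsilon> * q u) K \<and> smooth_body K \<and> C2_plus_body K \<and>
        constant_width K (2 * r) \<and> hausdorff_dist K (cball 0 r) \<le> C * \<bar>\<epsilon>\<bar>"
proof -
  interpret symmetric_trilinear B by fact
  obtain C where C: "C > 0" "\<And>x y. norm (B x y) \<le> norm x * norm y * C"
    using B.pos_bounded by blast
  interpret bounded_symmetric_trilinear B C
    by unfold_locales (use C in \<open>simp_all add: ac_simps\<close>)
  show thesis
  proof (rule that[OF C(1)])
    fix r \<epsilon> :: real assume "r > 0" "20 * C * \<bar>\<epsilon>\<bar> \<le> r"
    then interpret perturbed_ball B C r \<epsilon>
      by unfold_locales
    have "is_support_fun_of (\<lambda>u. r + \<epsilon> * q u) body"
      by (simp add: is_support_fun_of_def support_fun_body h_def q)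
    then show "\<exists>K. is_support_fun_of (\<lambda>u. r + \<epsilon> * q u) K \<and> smooth_body K \<and> C2_plus_body K \<and>
        constant_width K (2 * r) \<and> hausdorff_dist K (cball 0 r) \<le> C * \<bar>\<epsilon>\<bar>"
      using smooth_body_body C2_plus_body_body constant_width_body hausdorff_dist_body by blast
  qed
qed

text \<open>The constant \<open>r\<close> drops out of the odd part. Only values on the sphere
  enter, so the lemma applies to the explicit formula and to \<open>support_fun K\<close>
  alike.\<close>

lemma quartic_invariant_perturbation:
  fixes B :: "real^4 \<Rightarrow> real^4 \<Rightarrow> real^4"
  assumes B: "symmetric_trilinear B"
    and q: "\<And>u. norm u = 1 \<Longrightarrow> q u = symmetric_trilinear.cubic B u"
    and h: "\<And>u. norm u = 1 \<Longrightarrow> h u = r + \<epsilon> * q u"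
  shows "quartic_invariant h = \<epsilon> ^ 4 * mixed_volume q q q q"
  unfolding quartic_invariant_def
proof (rule mixed_volume_scaled[OF B q])
  interpret symmetric_trilinear B by fact
  fix u :: "real^4" assume "norm u = 1"
  then show "odd_part h u = \<epsilon> * q u"
    by (simp add: odd_part_def h q cubic_minus)
qed

theorem lemma9p1:
  shows
    "(\<forall>q\<in>{q_minus, q_plus}. odd_on_sphere q \<and> spherical_harmonic 3 q) \<and>
     - mixed_volume q_minus q_minus (\<lambda>_. 1) (\<lambda>_. 1) = (sphere_L2_norm q_minus)\<^sup>2 \<and>
     (sphere_L2_norm q_minus)\<^sup>2 = pi\<^sup>2 / 32 \<and>
     mixed_volume q_minus q_minus q_minus q_minus = - (3 * pi\<^sup>2 / 128) \<and>
     - mixed_volume q_plus q_plus (\<lambda>_. 1) (\<lambda>_. 1) = (sphere_L2_norm q_plus)\<^sup>2 \<and>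
     (sphere_L2_norm q_plus)\<^sup>2 = pi\<^sup>2 / 12 \<and>
     mixed_volume q_plus q_plus q_plus q_plus = pi\<^sup>2 / 7 \<and>
     (\<forall>q\<in>{q_minus, q_plus}. \<forall>r>0. \<forall>\<^sub>F \<epsilon> in at (0::real).
        (\<exists>K. is_support_fun_of (\<lambda>u. r + \<epsilon> * q u) K \<and>
             smooth_body K \<and> C2_plus_body K \<and> constant_width K (2 * r)) \<and>
        quartic_invariant (\<lambda>u. r + \<epsilon> * q u) = \<epsilon> ^ 4 * mixed_volume q q q q) \<and>
     (\<forall>r>0. \<forall>\<delta>>0.
        (\<exists>K. smooth_body K \<and> C2_plus_body K \<and> constant_width K (2 * r) \<and>
             hausdorff_dist K (cball 0 r) < \<delta> \<and> quartic_invariant (support_fun K) > 0) \<and>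
        (\<exists>K. smooth_body K \<and> C2_plus_body K \<and> constant_width K (2 * r) \<and>
             hausdorff_dist K (cball 0 r) < \<delta> \<and> quartic_invariant (support_fun K) < 0))"
proof -
  have cubic: "\<exists>B. symmetric_trilinear B \<and> (\<forall>u. norm u = 1 \<longrightarrow> q u = symmetric_trilinear.cubic B u)"
    if "q \<in> {q_minus, q_plus}" for q
    using that minus.symmetric_trilinear_axioms plus.symmetric_trilinear_axioms
      q_minus_eq_cubic q_plus_eq_cubic by blast
  have odd: "odd_on_sphere q" if "q \<in> {q_minus, q_plus}" for q
    using that by (auto simp: odd_on_sphere_def q_minus_def q_plus_def power3_eq_cube)
  have perturb: "\<forall>\<^sub>F \<epsilon> in at (0::real).
        (\<exists>K. is_support_fun_of (\<lambda>u. r + \<epsilon> * q u) K \<and>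
             smooth_body K \<and> C2_plus_body K \<and> constant_width K (2 * r)) \<and>
        quartic_invariant (\<lambda>u. r + \<epsilon> * q u) = \<epsilon> ^ 4 * mixed_volume q q q q"
    if q: "q \<in> {q_minus, q_plus}" and r: "r > 0" for q r
  proof -
    obtain B where B: "symmetric_trilinear B" "\<And>u. norm u = 1 \<Longrightarrow> q u = symmetric_trilinear.cubic B u"
      using cubic[OF q] by blast
    obtain C where C: "C > 0" and body: "\<And>r \<epsilon>. r > 0 \<Longrightarrow> 20 * C * \<bar>\<epsilon>\<bar> \<le> r \<Longrightarrow>
        \<exists>K. is_support_fun_of (\<lambda>u. r + \<epsilon> * q u) K \<and> smooth_body K \<and> C2_plus_body K \<and>
          constant_width K (2 * r) \<and> hausdorff_dist K (cball 0 r) \<le> C * \<bar>\<epsilon>\<bar>"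
      using constant_width_perturbation[OF B] by blast
    have "20 * C * \<bar>\<epsilon>\<bar> \<le> r" if "dist \<epsilon> 0 < r / (20 * C)" for \<epsilon>
      using that C by (simp add: field_simps)
    then show ?thesis
      unfolding eventually_at using r C body quartic_invariant_perturbation[OF B refl]
      by (intro exI[of _ "r / (20 * C)"]) (metis mult_pos_pos zero_less_divide_iff zero_less_numeral)
  qed
  \<comment> \<open>A nonzero \<open>\<epsilon>\<close> is recorded because
    \<open>\<epsilon> ^ 4\<close> is then positive and the invariant inherits the sign of the mixed
    volume.\<close>
  have nearby: "\<exists>K \<epsilon>. \<epsilon> \<noteq> 0 \<and> smooth_body K \<and> C2_plus_body K \<and> constant_width K (2 * r) \<and>
      hausdorff_dist K (cball 0 r) < \<delta> \<and> quartic_invariant (support_fun K) = \<epsilon> ^ 4 * mixed_volume q q q q"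
    if q: "q \<in> {q_minus, q_plus}" and r: "r > 0" and \<delta>: "\<delta> > 0" for q r and \<delta> :: real
  proof -
    obtain B where B: "symmetric_trilinear B" "\<And>u. norm u = 1 \<Longrightarrow> q u = symmetric_trilinear.cubic B u"
      using cubic[OF q] by blast
    obtain C where C: "C > 0" and body: "\<And>r \<epsilon>. r > 0 \<Longrightarrow> 20 * C * \<bar>\<epsilon>\<bar> \<le> r \<Longrightarrow>
        \<exists>K. is_support_fun_of (\<lambda>u. r + \<epsilon> * q u) K \<and> smooth_body K \<and> C2_plus_body K \<and>
          constant_width K (2 * r) \<and> hausdorff_dist K (cball 0 r) \<le> C * \<bar>\<epsilon>\<bar>"
      using constant_width_perturbation[OF B] by blast
    \<comment> \<open>The minimum with \<open>r\<close> meets the smallness condition; the minimum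
      with \<open>\<delta>\<close> gives \<open>C * \<epsilon> \<le> \<delta> / 20\<close>, below
      \<open>\<delta>\<close>.\<close>
    define \<epsilon> where "\<epsilon> = min r \<delta> / (20 * C)"
    have \<epsilon>: "\<epsilon> > 0" "20 * C * \<bar>\<epsilon>\<bar> \<le> r" "C * \<bar>\<epsilon>\<bar> < \<delta>"
      using r \<delta> C by (auto simp: \<epsilon>_def min_def field_simps)
    then obtain K where K: "is_support_fun_of (\<lambda>u. r + \<epsilon> * q u) K" "smooth_body K" "C2_plus_body K"
        "constant_width K (2 * r)" "hausdorff_dist K (cball 0 r) \<le> C * \<bar>\<epsilon>\<bar>"
      using body[OF r] by blast
    have "quartic_invariant (support_fun K) = \<epsilon> ^ 4 * mixed_volume q q q q"
      using K(1) by (intro quartic_invariant_perturbation[OF B, where r = r]) (auto simp: is_support_fun_of_def)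
    with K \<epsilon> show ?thesis
      by (intro exI[of _ K] exI[of _ \<epsilon>]) auto
  qed
  have signs: "mixed_volume q_plus q_plus q_plus q_plus > 0" "mixed_volume q_minus q_minus q_minus q_minus < 0"
    by (simp_all add: mixed_volume_q_plus mixed_volume_q_minus)
  have pos: "\<exists>K. smooth_body K \<and> C2_plus_body K \<and> constant_width K (2 * r) \<and>
      hausdorff_dist K (cball 0 r) < \<delta> \<and> quartic_invariant (support_fun K) > 0"
    if r: "r > 0" and \<delta>: "\<delta> > 0" for r \<delta> :: real
  proof -
    obtain K \<epsilon> where "\<epsilon> \<noteq> 0" "smooth_body K" "C2_plus_body K" "constant_width K (2 * r)"
        "hausdorff_dist K (cball 0 r) < \<delta>"
        "quartic_invariant (support_fun K) = \<epsilon> ^ 4 * mixed_volume q_plus q_plus q_plus q_plus"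
      using nearby[of q_plus, OF _ r \<delta>] by blast
    moreover from this signs(1) have "quartic_invariant (support_fun K) > 0"
      by simp
    ultimately show ?thesis
      by blast
  qed
  have neg: "\<exists>K. smooth_body K \<and> C2_plus_body K \<and> constant_width K (2 * r) \<and>
      hausdorff_dist K (cball 0 r) < \<delta> \<and> quartic_invariant (support_fun K) < 0"
    if r: "r > 0" and \<delta>: "\<delta> > 0" for r \<delta> :: real
  proof -
    obtain K \<epsilon> where "\<epsilon> \<noteq> 0" "smooth_body K" "C2_plus_body K" "constant_width K (2 * r)"
        "hausdorff_dist K (cball 0 r) < \<delta>"
        "quartic_invariant (support_fun K) = \<epsilon> ^ 4 * mixed_volume q_minus q_minus q_minus q_minus"
      using nearby[of q_minus, OF _ r \<delta>] by blast
    moreover from this signs(2) have "quartic_invariant (support_fun K) < 0"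
      by (simp add: mult_less_0_iff)
    ultimately show ?thesis
      by blast
  qed
  show ?thesis
    using odd spherical_harmonic_q_minus spherical_harmonic_q_plus
    by (intro conjI ballI allI impI perturb pos neg mixed_volume_q_minus_one mixed_volume_q_plus_one
        sphere_L2_norm_q_minus sphere_L2_norm_q_plus mixed_volume_q_minus mixed_volume_q_plus) auto
qed

end
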